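(* Let $V,W$ be finite-dimensional vector spaces over $\mathbb{K}\in\{\mathbb{R},\mathbb{C}\}$, let $(V,\mu)$ and $(W,\nu)$ be Lie algebras and let $f:(V,\mu)\to(W,\nu)$ be a morphism of Lie algebras. Let $\mathfrak{g}$ be the graded Lie algebra and $\mathfrak{h}_f\subseteq\mathfrak{g}$ the graded Lie subalgebra defined in the context. Assume that $$H^1\big(\mathfrak{g}/\mathfrak{h}_f,\overline{[(\mu,\nu),-]_{NR}}\big)=0.$$ Then there is an open neighborhood $\mathcal{U}$ of $(\mu,\nu)$ in the set of pairs of Lie algebra structures on $V$ and $W$ such that for every $(\mu',\nu')\in\mathcal{U}$ there is a family of pairs of endomorphisms $(A,B)\in\mathrm{End}(V)\oplus\mathrm{End}(W)$, parametrized by an open neighborhood of $0\in\mathrm{Der}(V,\mu)\oplus\mathrm{Der}(W,\nu)$, such that for each $(A,B)$ in the family $f$ is a morphism of Lie algebras $(V,(\mu')^A)\to(W,(\nu')^B)$.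
   Context: A Lie algebra structure on $V$ is an element $\mu\in\wedge^2V^\ast\otimes V$, viewed as a linear map $\wedge^2V\to V$, satisfying the Jacobi identity; the set of (pairs of) Lie algebra structures has the subspace topology. $\mathrm{Der}(V,\mu)$ denotes the space of derivations of the Lie algebra $(V,\mu)$. For $A\in\mathrm{End}(V)$ and $\mu'\in\wedge^2V^\ast\otimes V$, put $(\mu')^A:=\exp(A)\circ\mu'(\exp(-A)-,\exp(-A)-)$, and similarly $(\nu')^B$ for $B\in\mathrm{End}(W)$, $\nu'\in\wedge^2W^\ast\otimes W$. A family in a set $X$ parametrized by $O$ is a map $O\to X$. The Nijenhuis–Richardson bracket on $\wedge^{\bullet+1}V^\ast\otimes V$ (where $\wedge^{k+1}V^\ast\otimes V$ has degree $k$) is, for $\alpha\otimes v$ of degree $k$ and $\beta\otimes w$ of degree $l$, $$[\alpha\otimes v,\beta\otimes w]_{NR}=\beta\wedge\iota_w(\alpha)\otimes v-(-1)^{kl}\alpha\wedge\iota_v(\beta)\otimes w .$$ It is a graded Lie bracket, and $\mu\in\wedge^2V^\ast\otimes V$ is a Lie algebra structure iff $[\mu,\mu]_{NR}=0$. Let $$\mathfrak{g}^\bullet:=\wedge^{\bullet+1}V^\ast\otimes V\ \oplus\ \wedge^{\bullet+1}W^\ast\otimes W,$$ with the Nijenhuis–Richardson bracket on each summand and vanishing brackets between the two summands. Then $[(\mu,\nu),-]_{NR}$ is a differential of degree $1$ on $\mathfrak{g}$. Define $$F^\bullet:\mathfrak{g}^\bullet\to\wedge^{\bullet+1}V^\ast\otimes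 W,\qquad F(\alpha,\beta)=f\circ\alpha-\beta\circ f^{\wedge(\bullet+1)},$$ and $\mathfrak{h}_f^\bullet:=\ker(F^\bullet)$. This is a graded Lie subalgebra of $\mathfrak{g}^\bullet$ containing $(\mu,\nu)$ in degree $1$, so $[(\mu,\nu),-]_{NR}$ induces a differential $\overline{[(\mu,\nu),-]_{NR}}$ on $\mathfrak{g}/\mathfrak{h}_f$; $H^1$ denotes its cohomology in degree $1$. *)

theory Defs
  imports
    "HOL-Analysis.Analysis"
    "HOL-Algebra.Elementary_Groups"
    "HOL-Library.Function_Algebras"
begin

section \<open>Finite-dimensional vector spaces over the reals or the complex numbers\<close>

text \<open>
  A scalar type in the classes \<open>real_normed_field\<close> and \<open>euclidean_space\<close> is a finite field
  extension of the reals, that is, the reals or the complex numbers up to isomorphism. The last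
  assumption below says that the real vector space structure coming with the type of vectors is the
  restriction of scalars of \<open>scale\<close>. The norm of that type only serves to name the topology:
  in finite dimension all norms induce the same one, and one always exists. Dimension zero is
  allowed.
\<close>

locale fd_space = finite_dimensional_vector_space scale Basis
  for scale :: "'k::{real_normed_field,euclidean_space} \<Rightarrow> 'v::real_normed_vector \<Rightarrow> 'v"
    and Basis :: "'v set" +
  assumes scale_of_real: "scale (of_real r) x = r *\<^sub>R x"

abbreviation linear_over ::
    "('k::field \<Rightarrow> 'v::ab_group_add \<Rightarrow> 'v) \<Rightarrow> ('k \<Rightarrow> 'w::ab_group_add \<Rightarrow> 'w) \<Rightarrow> ('v \<Rightarrow> 'w) \<Rightarrow> bool"
  where "linear_over \<equiv> Vector_Spaces.linear"

definition endos :: "('k::field \<Rightarrow> 'v::ab_group_add \<Rightarrow> 'v) \<Rightarrow> ('v \<Rightarrow> 'v) set"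
  where "endos s = {A. linear_over s s A}"


section \<open>Lie algebra structures\<close>

text \<open>
  Structures and endomorphisms are plain functions. Function types carry the topology of pointwise
  convergence; on the finite-dimensional spaces of bilinear and of linear maps this is the usual
  vector space topology.
\<close>

definition lie_structures :: "('k::field \<Rightarrow> 'v::ab_group_add \<Rightarrow> 'v) \<Rightarrow> ('v \<Rightarrow> 'v \<Rightarrow> 'v) set"
  where "lie_structures s = {\<mu>.
    (\<forall>x. linear_over s s (\<lambda>y. \<mu> x y)) \<and> (\<forall>y. linear_over s s (\<lambda>x. \<mu> x y)) \<and>
    (\<forall>x. \<mu> x x = 0) \<and>
    (\<forall>x y z. \<mu> x (\<mu> y z) + \<mu> y (\<mu> z x) + \<mu> z (\<mu> x y) = 0)}"

definition lie_morphism ::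
    "('k::field \<Rightarrow> 'v::ab_group_add \<Rightarrow> 'v) \<Rightarrow> ('k \<Rightarrow> 'w::ab_group_add \<Rightarrow> 'w) \<Rightarrow>
     ('v \<Rightarrow> 'v \<Rightarrow> 'v) \<Rightarrow> ('w \<Rightarrow> 'w \<Rightarrow> 'w) \<Rightarrow> ('v \<Rightarrow> 'w) \<Rightarrow> bool"
  where "lie_morphism sV sW \<mu> \<nu> f \<longleftrightarrow>
    linear_over sV sW f \<and> (\<forall>x y. f (\<mu> x y) = \<nu> (f x) (f y))"

definition derivations ::
    "('k::field \<Rightarrow> 'v::ab_group_add \<Rightarrow> 'v) \<Rightarrow> ('v \<Rightarrow> 'v \<Rightarrow> 'v) \<Rightarrow> ('v \<Rightarrow> 'v) set"
  where "derivations s \<mu> = {D \<in> endos s. \<forall>x y. D (\<mu> x y) = \<mu> (D x) y + \<mu> x (D y)}"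

definition endo_exp :: "('v::real_normed_vector \<Rightarrow> 'v) \<Rightarrow> 'v \<Rightarrow> 'v"
  where "endo_exp A v = (\<Sum>n. (A ^^ n) v /\<^sub>R fact n)"

definition twist ::
    "('v::real_normed_vector \<Rightarrow> 'v) \<Rightarrow> ('v \<Rightarrow> 'v \<Rightarrow> 'v) \<Rightarrow> 'v \<Rightarrow> 'v \<Rightarrow> 'v"
  where "twist A \<mu> = (\<lambda>x y. endo_exp A (\<mu> (endo_exp (- A) x) (endo_exp (- A) y)))"


section \<open>Alternating maps and the Nijenhuis--Richardson bracket\<close>

text \<open>
  The space of alternating \<open>p\<close>-linear maps. Such a map is encoded as a function on lists that
  vanishes on all lists of length different from \<open>p\<close>.
\<close>

definition alt_maps ::
    "('k::field \<Rightarrow> 'v::ab_group_add \<Rightarrow> 'v) \<Rightarrow> ('k \<Rightarrow> 'w::ab_group_add \<Rightarrow> 'w) \<Rightarrow> nat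
     \<Rightarrow> ('v list \<Rightarrow> 'w) set"
  where "alt_maps sV sW p = {P.
    (\<forall>xs. length xs \<noteq> p \<longrightarrow> P xs = 0) \<and>
    (\<forall>xs i. length xs = p \<and> i < p \<longrightarrow> linear_over sV sW (\<lambda>v. P (xs[i := v]))) \<and>
    (\<forall>xs i j. length xs = p \<and> i < j \<and> j < p \<and> xs ! i = xs ! j \<longrightarrow> P xs = 0)}"

definition bin_cochain :: "('v \<Rightarrow> 'v \<Rightarrow> 'w::zero) \<Rightarrow> 'v list \<Rightarrow> 'w"
  where "bin_cochain \<mu> xs = (case xs of [x, y] \<Rightarrow> \<mu> x y | _ \<Rightarrow> 0)"

text \<open>
  A \<open>(p, q)\<close>-shuffle is given by the set \<open>S\<close> of the \<open>p\<close> positions that come first; its sign is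
  determined by the number of inversions.
\<close>

definition shuffle_sets :: "nat \<Rightarrow> nat \<Rightarrow> nat set set"
  where "shuffle_sets p q = {S. S \<subseteq> {..<p + q} \<and> card S = p}"

definition shuffle_sign :: "nat set \<Rightarrow> real"
  where "shuffle_sign S = (-1) ^ card {(i, j). i \<in> S \<and> j \<notin> S \<and> j < i}"

text \<open>
  The insertion of \<open>Q\<close> (degree \<open>l\<close>, \<open>l + 1\<close> arguments) into \<open>P\<close> (degree \<open>k\<close>, \<open>k + 1\<close> arguments)
  is the bilinear extension of
  \<open>(\<alpha> \<otimes> v, \<beta> \<otimes> w) \<mapsto> (\<beta> \<and> \<iota>\<^sub>w \<alpha>) \<otimes> v\<close>; see \<open>nr_bracket_tensor\<close>,
  \<open>nr_bracket_add_left\<close> and \<open>nr_bracket_add_right\<close> below.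
\<close>

definition nr_insert ::
    "nat \<Rightarrow> nat \<Rightarrow> ('v list \<Rightarrow> 'v::real_vector) \<Rightarrow> ('v list \<Rightarrow> 'v) \<Rightarrow> 'v list \<Rightarrow> 'v"
  where "nr_insert k l P Q xs =
    (if length xs = k + l + 1
     then \<Sum>S \<in> shuffle_sets (l + 1) k.
            shuffle_sign S *\<^sub>R P (Q (nths xs S) # nths xs (- S))
     else 0)"

definition nr_bracket ::
    "nat \<Rightarrow> nat \<Rightarrow> ('v list \<Rightarrow> 'v::real_vector) \<Rightarrow> ('v list \<Rightarrow> 'v) \<Rightarrow> 'v list \<Rightarrow> 'v"
  where "nr_bracket k l P Q xs =
    nr_insert k l P Q xs - (-1) ^ (k * l) *\<^sub>R nr_insert l k Q P xs"

definition wedge ::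
    "nat \<Rightarrow> nat \<Rightarrow> ('v list \<Rightarrow> 'k::real_algebra_1) \<Rightarrow> ('v list \<Rightarrow> 'k) \<Rightarrow> 'v list \<Rightarrow> 'k"
  where "wedge p q \<alpha> \<beta> xs =
    (if length xs = p + q
     then \<Sum>S \<in> shuffle_sets p q. shuffle_sign S *\<^sub>R (\<alpha> (nths xs S) * \<beta> (nths xs (- S)))
     else 0)"

definition interior_prod :: "'v \<Rightarrow> ('v list \<Rightarrow> 'k) \<Rightarrow> 'v list \<Rightarrow> 'k"
  where "interior_prod w \<alpha> xs = \<alpha> (w # xs)"

definition form_tensor :: "('k \<Rightarrow> 'v \<Rightarrow> 'v) \<Rightarrow> ('v list \<Rightarrow> 'k) \<Rightarrow> 'v \<Rightarrow> 'v list \<Rightarrow> 'v"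
  where "form_tensor s \<alpha> v xs = s (\<alpha> xs) v"

lemma length_nths_shuffle:
  assumes "S \<in> shuffle_sets p q" "length xs = p + q"
  shows "length (nths xs S) = p" "length (nths xs (- S)) = q"
proof -
  have S: "S \<subseteq> {..<p + q}" "card S = p" "finite S"
    using assms(1) finite_subset by (auto simp: shuffle_sets_def)
  have e1: "{i. i < length xs \<and> i \<in> S} = S"
    using S assms(2) by auto
  have e2: "{i. i < length xs \<and> i \<in> - S} = {..<p + q} - S"
    using assms(2) by auto
  show "length (nths xs S) = p"
    unfolding length_nths e1 by (rule S(2))
  show "length (nths xs (- S)) = q"
    unfolding length_nths e2 using S by (simp add: card_Diff_subset)
qed

lemma alt_maps_linear_hd:
  assumes "P \<in> alt_maps sV sW (Suc p)" "length ys = p"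
  shows "linear_over sV sW (\<lambda>v. P (v # ys))"
proof -
  have "linear_over sV sW (\<lambda>v. P ((undefined # ys)[0 := v]))"
    using assms unfolding alt_maps_def mem_Collect_eq
    by (metis length_Cons zero_less_Suc)
  then show ?thesis by simp
qed

lemma (in fd_space) nr_insert_tensor:
  assumes \<alpha>: "\<alpha> \<in> alt_maps scale (*) (k + 1)"
  shows "nr_insert k l (form_tensor scale \<alpha> v) (form_tensor scale \<beta> w) =
    form_tensor scale (wedge (l + 1) k \<beta> (interior_prod w \<alpha>)) v"
proof
  fix xs :: "'v list"
  show "nr_insert k l (form_tensor scale \<alpha> v) (form_tensor scale \<beta> w) xs =
    form_tensor scale (wedge (l + 1) k \<beta> (interior_prod w \<alpha>)) v xs"
  proof (cases "length xs = k + l + 1")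
    case True
    have "shuffle_sign S *\<^sub>R scale (\<alpha> (scale (\<beta> (nths xs S)) w # nths xs (- S))) v =
        scale (shuffle_sign S *\<^sub>R (\<beta> (nths xs S) * \<alpha> (w # nths xs (- S)))) v"
      if S: "S \<in> shuffle_sets (l + 1) k" for S
    proof -
      have "length (nths xs (- S)) = k"
        using length_nths_shuffle(2)[OF S] True by (simp add: add.commute)
      then have "linear_over scale (*) (\<lambda>u. \<alpha> (u # nths xs (- S)))"
        using alt_maps_linear_hd[of \<alpha> scale "(*)" k] \<alpha> by simp
      then interpret L: Vector_Spaces.linear scale "(*)" "\<lambda>u. \<alpha> (u # nths xs (- S))" .
      show ?thesis
        by (simp add: L.scale scale_of_real[symmetric] scaleR_conv_of_real)
    qed
    then show ?thesis
      using True
      by (auto simp: nr_insert_def wedge_def form_tensor_def interior_prod_def scale_sum_left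
          intro!: sum.cong)
  qed (auto simp: nr_insert_def wedge_def form_tensor_def)
qed

lemma (in fd_space) nr_bracket_tensor:
  assumes "\<alpha> \<in> alt_maps scale (*) (k + 1)" "\<beta> \<in> alt_maps scale (*) (l + 1)"
  shows "nr_bracket k l (form_tensor scale \<alpha> v) (form_tensor scale \<beta> w) xs =
    form_tensor scale (wedge (l + 1) k \<beta> (interior_prod w \<alpha>)) v xs
    - (-1) ^ (k * l) *\<^sub>R form_tensor scale (wedge (k + 1) l \<alpha> (interior_prod v \<beta>)) w xs"
  by (simp only: nr_bracket_def nr_insert_tensor[OF assms(1)] nr_insert_tensor[OF assms(2)])

lemma nr_insert_add_left: "nr_insert k l (P + P') Q = nr_insert k l P Q + nr_insert k l P' Q"
  by (auto simp: fun_eq_iff nr_insert_def scaleR_add_right sum.distrib)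

lemma nr_insert_add_right:
  assumes P: "P \<in> alt_maps s s (k + 1)"
  shows "nr_insert k l P (Q + Q') = nr_insert k l P Q + nr_insert k l P Q'"
proof
  fix xs :: "'a list"
  have "P ((Q + Q') (nths xs S) # nths xs (- S)) =
      P (Q (nths xs S) # nths xs (- S)) + P (Q' (nths xs S) # nths xs (- S))"
    if S: "S \<in> shuffle_sets (l + 1) k" and len: "length xs = k + l + 1" for S
  proof -
    have "length (nths xs (- S)) = k"
      using length_nths_shuffle(2)[OF S] len by (simp add: add.commute)
    then have "linear_over s s (\<lambda>u. P (u # nths xs (- S)))"
      using alt_maps_linear_hd[of P s s k] P by simp
    then interpret L: Vector_Spaces.linear s s "\<lambda>u. P (u # nths xs (- S))" .
    show ?thesis by (simp add: L.add)
  qed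
  then show "nr_insert k l P (Q + Q') xs = (nr_insert k l P Q + nr_insert k l P Q') xs"
    by (cases "length xs = k + l + 1")
      (auto simp: nr_insert_def scaleR_add_right simp flip: sum.distrib intro!: sum.cong)
qed

lemma nr_bracket_add_left:
  assumes "Q \<in> alt_maps s s (l + 1)"
  shows "nr_bracket k l (P + P') Q = nr_bracket k l P Q + nr_bracket k l P' Q"
  by (auto simp: fun_eq_iff nr_bracket_def nr_insert_add_left nr_insert_add_right[OF assms]
      algebra_simps)

lemma nr_bracket_add_right:
  assumes "P \<in> alt_maps s s (k + 1)"
  shows "nr_bracket k l P (Q + Q') = nr_bracket k l P Q + nr_bracket k l P Q'"
  by (auto simp: fun_eq_iff nr_bracket_def nr_insert_add_left nr_insert_add_right[OF assms]
      algebra_simps)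


section \<open>The graded Lie algebra, its subalgebra and the quotient complex\<close>

text \<open>
  Only degrees \<open>k \<ge> 0\<close> are considered, since degree one cohomology involves just the degrees
  zero to two.
\<close>

definition g_space ::
    "('k::field \<Rightarrow> 'v::ab_group_add \<Rightarrow> 'v) \<Rightarrow> ('k \<Rightarrow> 'w::ab_group_add \<Rightarrow> 'w) \<Rightarrow> nat
     \<Rightarrow> (('v list \<Rightarrow> 'v) \<times> ('w list \<Rightarrow> 'w)) set"
  where "g_space sV sW k = alt_maps sV sV (k + 1) \<times> alt_maps sW sW (k + 1)"

definition g_bracket ::
    "nat \<Rightarrow> nat \<Rightarrow> ('v list \<Rightarrow> 'v::real_vector) \<times> ('w list \<Rightarrow> 'w::real_vector)
     \<Rightarrow> ('v list \<Rightarrow> 'v) \<times> ('w list \<Rightarrow> 'w) \<Rightarrow> ('v list \<Rightarrow> 'v) \<times> ('w list \<Rightarrow> 'w)"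
  where "g_bracket k l x y =
    (nr_bracket k l (fst x) (fst y), nr_bracket k l (snd x) (snd y))"

definition g_diff ::
    "('v \<Rightarrow> 'v \<Rightarrow> 'v::real_vector) \<Rightarrow> ('w \<Rightarrow> 'w \<Rightarrow> 'w::real_vector) \<Rightarrow> nat
     \<Rightarrow> ('v list \<Rightarrow> 'v) \<times> ('w list \<Rightarrow> 'w) \<Rightarrow> ('v list \<Rightarrow> 'v) \<times> ('w list \<Rightarrow> 'w)"
  where "g_diff \<mu> \<nu> k = g_bracket 1 k (bin_cochain \<mu>, bin_cochain \<nu>)"

definition F_map ::
    "('v \<Rightarrow> 'w::ab_group_add) \<Rightarrow> ('v list \<Rightarrow> 'v) \<times> ('w list \<Rightarrow> 'w) \<Rightarrow> 'v list \<Rightarrow> 'w"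
  where "F_map f x = (\<lambda>xs. f (fst x xs) - snd x (map f xs))"

definition h_space ::
    "('k::field \<Rightarrow> 'v::ab_group_add \<Rightarrow> 'v) \<Rightarrow> ('k \<Rightarrow> 'w::ab_group_add \<Rightarrow> 'w) \<Rightarrow> ('v \<Rightarrow> 'w) \<Rightarrow> nat
     \<Rightarrow> (('v list \<Rightarrow> 'v) \<times> ('w list \<Rightarrow> 'w)) set"
  where "h_space sV sW f k = {x \<in> g_space sV sW k. F_map f x = 0}"

text \<open>
  Quotients of vector spaces are formed as quotients of the underlying additive groups, which
  suffices to say that a cohomology space vanishes.
\<close>

definition additive_group :: "'a::ab_group_add set \<Rightarrow> 'a monoid"
  where "additive_group S = \<lparr>carrier = S, monoid.mult = (+), one = 0\<rparr>"

definition quot_group ::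
    "(nat \<Rightarrow> 'a::ab_group_add set) \<Rightarrow> (nat \<Rightarrow> 'a set) \<Rightarrow> nat \<Rightarrow> 'a set monoid"
  where "quot_group g h k = additive_group (g k) Mod h k"

text \<open>
  The map induced on cosets; when \<open>d k\<close> is additive and sends \<open>h k\<close> into \<open>h (k + 1)\<close>, all
  cosets in the union agree.
\<close>

definition quot_diff ::
    "(nat \<Rightarrow> 'a::ab_group_add set) \<Rightarrow> (nat \<Rightarrow> 'a set) \<Rightarrow> (nat \<Rightarrow> 'a \<Rightarrow> 'a) \<Rightarrow> nat
     \<Rightarrow> 'a set \<Rightarrow> 'a set"
  where "quot_diff g h d k C = (\<Union>x\<in>C. h (k + 1) #>\<^bsub>additive_group (g (k + 1))\<^esub> d k x)"

definition quot_H1 ::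
    "(nat \<Rightarrow> 'a::ab_group_add set) \<Rightarrow> (nat \<Rightarrow> 'a set) \<Rightarrow> (nat \<Rightarrow> 'a \<Rightarrow> 'a) \<Rightarrow> 'a set set monoid"
  where "quot_H1 g h d =
    (quot_group g h 1)\<lparr>carrier := kernel (quot_group g h 1) (quot_group g h 2) (quot_diff g h d 1)\<rparr>
    Mod (quot_diff g h d 0 ` carrier (quot_group g h 0))"

end

theory Submission
  imports Defs
begin

text \<open>
  Twisting \<open>\<mu>'\<close> by \<open>exp A\<close> and \<open>\<nu>'\<close> by \<open>exp B\<close> moves the pair \<open>p = (\<mu>', \<nu>')\<close> along its orbit under the
  gauge group, and \<open>f\<close> is a morphism of the resulting algebras iff the twisted pair lies in the
  linear space \<open>h = ker F\<close> of compatible pairs. The theorem therefore says that the gauge orbit of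
  every Lie pair close to \<open>m0 = (\<mu>, \<nu>)\<close> meets \<open>h\<close>.

  The Jacobi identity is quadratic. Let \<open>J (p, q)\<close> be the symmetric bilinear form polarizing the
  Jacobiator and \<open>B (p, q) = F (J (p, q))\<close>. Then \<open>B (p, p) = 0\<close> for Lie pairs \<open>p\<close>, and \<open>B\<close> vanishes on
  \<open>h \<times> h\<close> because \<open>h\<close> is closed under the bracket. The linear map \<open>B (m0, -)\<close> is the differential
  of the quotient complex, so its kernel \<open>Z\<close> consists of the representatives of cocycles, and the
  vanishing of \<open>H\<^sup>1\<close> says that \<open>Z\<close> is the sum of \<open>h\<close> and of the directions tangent at \<open>m0\<close> to the
  gauge orbit (\<open>infinitesimal_stability\<close>).

  Let \<open>N\<close> be a complement of \<open>Z\<close>. The gauge directions together with \<open>h + N\<close> span everything, so by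
  an open mapping argument every pair \<open>p\<close> near \<open>m0\<close> can be moved by a gauge transformation
  to a pair \<open>y + c\<close> near \<open>m0\<close> with \<open>y \<in> h\<close> close to \<open>m0\<close> and \<open>c \<in> N\<close> small. For a Lie pair \<open>p\<close> this gives
  \<open>0 = B (y + c, y + c) = 2 B (y, c) + B (c, c)\<close>. As \<open>B (m0, -)\<close> is injective on \<open>N\<close>, the norm of
  \<open>B (y, c)\<close> is at least a fixed multiple of the norm of \<open>c\<close>, whereas \<open>B (c, c)\<close> is quadratically
  small; hence \<open>c = 0\<close>. This is \<open>rigidity_of_zero_set\<close>, stated for Euclidean spaces. The rest is the
  translation: linear coordinates on \<open>V\<close> and \<open>W\<close>, in which pairs of structures form a Euclidean
  space, the regularity of the exponential, and explicit formulas for the Nijenhuis--Richardson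
  bracket in low degrees.
\<close>

section \<open>Rigidity of the zero set of a quadratic map\<close>

text \<open>
  \<open>T (e, -)\<close> plays the role of the action of a gauge transformation \<open>e\<close>, \<open>h\<close> that of the compatible
  points and \<open>B\<close> that of the polarized obstruction. Let \<open>N\<close> be the orthogonal complement of the kernel
  \<open>Z\<close> of \<open>B m0\<close> in \<open>S\<close>. By \<open>infinitesimal\<close>, the orbit of every point near \<open>m0\<close> meets \<open>h + N\<close> near \<open>m0\<close>,
  and there a zero of the quadratic form in \<open>S\<close> has no component in \<open>N\<close>.
\<close>

lemma rigidity_of_zero_set:
  fixes T :: "'e::euclidean_space \<times> 'm::euclidean_space \<Rightarrow> 'm"
    and B :: "'m \<Rightarrow> 'm \<Rightarrow> 'y::euclidean_space"
    and S h :: "'m set"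
  assumes S: "subspace S" and h: "subspace h" and hS: "h \<subseteq> S" and m0: "m0 \<in> h"
    and B: "bounded_bilinear B" and B_sym: "\<And>x y. B x y = B y x"
    and B_h: "\<And>x y. x \<in> h \<Longrightarrow> y \<in> h \<Longrightarrow> B x y = 0"
    and T_cont: "continuous_on UNIV T" and T_der: "(T has_derivative T') (at (0, m0))"
    and T_m0: "T (0, m0) = m0" and T_S: "\<And>e m. m \<in> S \<Longrightarrow> T (e, m) \<in> S"
    and infinitesimal: "\<And>x. x \<in> S \<Longrightarrow> B m0 x = 0 \<Longrightarrow> \<exists>e. x - T' (e, 0) \<in> h"
  shows "\<exists>U. open U \<and> m0 \<in> U \<and>
    (\<forall>m\<in>U \<inter> S. (\<forall>e. B (T (e, m)) (T (e, m)) = 0) \<longrightarrow> (\<exists>e. T (e, m) \<in> h))"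
proof -
  interpret B: bounded_bilinear B by (rule B)
  have T'_lin: "linear T'" using T_der has_derivative_linear by blast
  define Z where "Z = {x \<in> S. B m0 x = 0}"
  define N where "N = {n. \<forall>z\<in>Z. orthogonal n z}"
  have Z: "subspace Z"
    using S unfolding Z_def subspace_def by (auto simp: B.add_right B.scaleR_right B.zero_right)
  have hZ: "h \<subseteq> Z" using hS B_h m0 unfolding Z_def by blast
  have N: "subspace N"
    unfolding N_def by (auto simp: subspace_def orthogonal_clauses)
  define H where "H = {y + n |y n. y \<in> h \<and> n \<in> N}"
  have H: "subspace H" unfolding H_def by (rule subspace_sums[OF h N])
  obtain P where P: "linear P" "range P \<subseteq> H" "\<And>x. x \<in> H \<Longrightarrow> P x = x"
    using linear_exists_left_inverse_on[of id H] H by (auto simp: linear_id)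
  have m0H: "m0 \<in> H" unfolding H_def using m0 subspace_0[OF N] by force
  have split: "\<exists>e. u - T' (e, 0) \<in> H" for u
  proof -
    obtain z n where zn: "z \<in> span Z" "\<And>w. w \<in> span Z \<Longrightarrow> orthogonal n w" "u = z + n"
      using orthogonal_subspace_decomp_exists[of Z u] by blast
    then have z: "z \<in> Z" and n: "n \<in> N"
      using Z by (auto simp: N_def span_eq_iff[THEN iffD2])
    obtain e where "z - T' (e, 0) \<in> h" using z infinitesimal unfolding Z_def by blast
    then have "(z - T' (e, 0)) + n \<in> H" unfolding H_def using n by blast
    then show ?thesis using zn(3) by (metis add_diff_eq add.commute)
  qed
  \<comment> \<open>Carrying \<open>m\<close> along as a third component turns the statement about all \<open>m\<close> near \<open>m0\<close>
    into an open mapping statement at the single point \<open>(0, m0, m0)\<close>.\<close>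
  define \<Theta> where "\<Theta> = (\<lambda>(e, x, m). (T (e, m) - P x, m))"
  define \<Theta>' where "\<Theta>' = (\<lambda>(e, x, m). (T' (e, m) - P x, m))"
  have P_bl: "bounded_linear P" using P(1) linear_conv_bounded_linear by blast
  have \<Theta>_cont: "continuous_on UNIV \<Theta>"
    unfolding \<Theta>_def case_prod_unfold
    by (intro continuous_intros continuous_on_compose2[OF T_cont]
        continuous_on_compose2[OF linear_continuous_on[OF P_bl, of UNIV]]) auto
  have \<Theta>_der: "(\<Theta> has_derivative \<Theta>') (at (0, m0, m0))"
  proof -
    have pr: "((\<lambda>p. (fst p, snd (snd p))) has_derivative (\<lambda>p. (fst p, snd (snd p))))
        (at (0::'e, m0, m0))"
      by (auto intro!: derivative_eq_intros)
    have "((\<lambda>p. T (fst p, snd (snd p))) has_derivative (\<lambda>p. T' (fst p, snd (snd p))))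
        (at (0, m0, m0))"
      using has_derivative_compose[OF pr, of T T'] T_der by simp
    moreover have "((\<lambda>p. P (fst (snd p))) has_derivative (\<lambda>p. P (fst (snd p)))) (at (0::'e, m0, m0))"
      by (rule bounded_linear.has_derivative[OF P_bl]) (auto intro!: derivative_eq_intros)
    ultimately show ?thesis
      unfolding \<Theta>_def \<Theta>'_def case_prod_unfold by (auto intro!: derivative_eq_intros)
  qed
  have \<Theta>'_lin: "linear \<Theta>'"
    using \<Theta>_der has_derivative_linear by blast
  have "surj \<Theta>'"
    unfolding surj_def
  proof
    fix q :: "'m \<times> 'm"
    obtain t m where q: "q = (t, m)" by (cases q)
    obtain e where e: "(t - T' (0, m)) - T' (e, 0) \<in> H" using split by blast
    have "T' (e, m) = T' (e, 0) + T' (0, m)"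
      using linear_add[OF T'_lin, of "(e, 0)" "(0, m)"] by simp
    moreover have "P (- ((t - T' (0, m)) - T' (e, 0))) = - ((t - T' (0, m)) - T' (e, 0))"
      by (rule P(3)[OF subspace_neg[OF H e]])
    ultimately have "\<Theta>' (e, - ((t - T' (0, m)) - T' (e, 0)), m) = q"
      by (simp add: \<Theta>'_def q)
    then show "\<exists>p. q = \<Theta>' p" by metis
  qed
  then obtain \<Theta>i where \<Theta>i: "linear \<Theta>i" "\<Theta>' \<circ> \<Theta>i = id"
    using linear_surjective_right_inverse[OF \<Theta>'_lin] by blast
  have Dm0: "bounded_linear (B m0)" by (rule B.bounded_linear_right)
  have NS: "subspace (N \<inter> S)" using N S subspace_Int[of "{True, False}"] 
    by (simp add: subspace_inter)
  have inj: "c = 0" if "c \<in> N \<inter> S" "B m0 c = 0" for c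
  proof -
    have "c \<in> Z" using that unfolding Z_def by blast
    then have "orthogonal c c" using that unfolding N_def by blast
    then show ?thesis by (simp add: orthogonal_self)
  qed
  obtain \<kappa> where \<kappa>: "\<kappa> > 0" "\<And>c. c \<in> N \<inter> S \<Longrightarrow> norm (B m0 c) \<ge> \<kappa> * norm c"
    using injective_imp_isometric[OF closed_subspace[OF NS] NS Dm0] inj by blast
  obtain K where K: "K > 0" "\<And>x y. norm (B x y) \<le> norm x * norm y * K"
    using B.pos_bounded by blast
  \<comment> \<open>With this radius the quadratic terms below are at most \<open>3/2 * \<kappa> * norm c\<close>, while the linear one is at least \<open>2 * \<kappa> * norm c\<close>.\<close>
  define \<delta> where "\<delta> = \<kappa> / (2 * K)"
  have \<delta>: "\<delta> > 0" using \<kappa> K by (simp add: \<delta>_def)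
  define W where "W = {p :: 'e \<times> 'm \<times> 'm. T (fst p, snd (snd p)) \<in> ball m0 \<delta>}"
  have "open W"
    unfolding W_def
    by (intro open_vimage[unfolded vimage_def, OF open_ball])
       (auto intro!: continuous_intros continuous_on_compose2[OF T_cont])
  moreover have "(0, m0, m0) \<in> W" using \<delta> T_m0 by (simp add: W_def)
  ultimately have "\<Theta> (0, m0, m0) \<in> interior (\<Theta> ` W)"
    using sussmann_open_mapping[OF open_UNIV \<Theta>_cont UNIV_I \<Theta>_der _ \<Theta>i(2), of W] \<Theta>i(1)
    by (simp add: linear_conv_bounded_linear interior_open)
  then have in0: "(0, m0) \<in> interior (\<Theta> ` W)" by (simp add: \<Theta>_def T_m0 P(3)[OF m0H])
  define U where "U = {m. (0, m) \<in> interior (\<Theta> ` W)}"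
  have "open U"
    unfolding U_def
    by (intro open_vimage[unfolded vimage_def, OF open_interior]) (auto intro!: continuous_intros)
  moreover have "m0 \<in> U" using in0 by (simp add: U_def)
  moreover have "\<exists>e. T (e, m) \<in> h" if mU: "m \<in> U" and mS: "m \<in> S"
    and J: "\<forall>e. B (T (e, m)) (T (e, m)) = 0" for m
  proof -
    have "(0, m) \<in> \<Theta> ` W" using mU interior_subset unfolding U_def by blast
    then obtain e x where ex: "(e, x, m) \<in> W" "T (e, m) = P x" by (auto simp: \<Theta>_def)
    then have "T (e, m) \<in> H" using P(2) by auto
    then obtain y c where yc: "y \<in> h" "c \<in> N" "T (e, m) = y + c" unfolding H_def by blast
    have "T (e, m) - y \<in> S" using yc(1) hS subspace_diff[OF S T_S[OF mS]] by blast
    then have c: "c \<in> N \<inter> S" using yc by simp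
    have near: "norm (T (e, m) - m0) < \<delta>"
      using ex(1) by (simp add: W_def dist_norm norm_minus_commute)
    have ym0: "y - m0 \<in> h" using yc m0 subspace_diff[OF h] by blast
    then have orth: "orthogonal (y - m0) c"
      using hZ c unfolding N_def by (auto simp: orthogonal_commute)
    \<comment> \<open>Orthogonality bounds both components of \<open>T (e, m) - m0\<close> by its norm.\<close>
    have "(norm (T (e, m) - m0))\<^sup>2 = (norm (y - m0))\<^sup>2 + (norm c)\<^sup>2"
      using norm_add_Pythagorean[OF orth] yc(3) by (simp add: algebra_simps)
    then have "(norm (y - m0))\<^sup>2 \<le> (norm (T (e, m) - m0))\<^sup>2"
      and "(norm c)\<^sup>2 \<le> (norm (T (e, m) - m0))\<^sup>2" by simp_all
    then have le: "norm (y - m0) \<le> norm (T (e, m) - m0)" "norm c \<le> norm (T (e, m) - m0)"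
      using power2_le_imp_le[OF _ norm_ge_zero] by blast+
    have "B y y = 0" using B_h yc by blast
    then have "B y c + B y c + B c c = 0"
      using J[rule_format, of e] unfolding yc(3) B.add_left B.add_right B_sym[of c y] by (simp add: add.assoc)
    moreover have "B y c = B m0 c + B (y - m0) c" by (simp add: B.diff_left)
    ultimately have "2 *\<^sub>R B m0 c + (2 *\<^sub>R B (y - m0) c + B c c) = 0"
      by (simp add: scaleR_2 add_ac)
    then have "2 *\<^sub>R B m0 c = - (2 *\<^sub>R B (y - m0) c + B c c)"
      by (simp only: eq_neg_iff_add_eq_0)
    then have "norm (2 *\<^sub>R B m0 c) \<le> norm (2 *\<^sub>R B (y - m0) c) + norm (B c c)"
      by (metis norm_minus_cancel norm_triangle_ineq)
    moreover have "norm (B (y - m0) c) \<le> norm (T (e, m) - m0) * norm c * K"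
      by (intro order_trans[OF K(2)] mult_right_mono le) (use K in auto)
    moreover have "norm (B c c) \<le> norm (T (e, m) - m0) * norm c * K"
      by (intro order_trans[OF K(2)] mult_right_mono le) (use K in auto)
    moreover note \<kappa>(2)[OF c]
    ultimately have bound: "2 * (\<kappa> * norm c) \<le> 3 * (norm (T (e, m) - m0) * norm c * K)" by simp
    have "c = 0"
    proof (rule ccontr)
      assume "c \<noteq> 0"
      have "norm c * (2 * \<kappa>) \<le> norm c * (3 * norm (T (e, m) - m0) * K)"
        using bound by (simp add: mult_ac)
      then have "2 * \<kappa> \<le> 3 * norm (T (e, m) - m0) * K"
        using \<open>c \<noteq> 0\<close> by (subst (asm) mult_le_cancel_left_pos) auto
      also have "\<dots> < 3 * \<delta> * K" using near K by simp
      also have "\<dots> = 3 / 2 * \<kappa>" using K by (simp add: \<delta>_def)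
      finally show False using \<kappa> by simp
    qed
    then show ?thesis using yc by auto
  qed
  ultimately show ?thesis by blast
qed

section \<open>Linear coordinates\<close>

text \<open>
  The open mapping theorem needs a target type of class \<open>euclidean_space\<close>, whose dimension is part of
  the type. This index type depends only on the type of vectors and is large enough to index a basis
  of it over any scalar field considered here. The extra element makes it nonempty in dimension zero,
  so that coordinates are in general redundant: an embedding with a left inverse.
\<close>

typedef (overloaded) ('v::real_vector) coord_index = "{..dim (UNIV :: 'v set)}"
  by blast

instance coord_index :: (real_vector) finite
proof
  have "(UNIV :: 'a coord_index set) = Abs_coord_index ` {..dim (UNIV :: 'a set)}"
    by (metis UNIV_eq_I Abs_coord_index_cases image_eqI)
  then show "finite (UNIV :: 'a coord_index set)" by (metis finite_atMost finite_imageI)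
qed

lemma card_coord_index: "CARD('v::real_vector coord_index) = Suc (dim (UNIV :: 'v set))"
  using type_definition.card[OF type_definition_coord_index] by simp

lemma bounded_linear_comp_bounded_bilinear:
  assumes "bounded_linear f" and "bounded_bilinear g"
  shows "bounded_bilinear (\<lambda>x y. f (g x y))"
proof -
  interpret f: bounded_linear f by fact
  interpret g: bounded_bilinear g by fact
  obtain K where K: "K \<ge> 0" "\<And>x. norm (f x) \<le> norm x * K" using f.nonneg_bounded by blast
  obtain L where L: "\<And>x y. norm (g x y) \<le> norm x * norm y * L" using g.bounded by blast
  show ?thesis
  proof
    show "\<exists>M. \<forall>x y. norm (f (g x y)) \<le> norm x * norm y * M"
    proof (intro exI[of _ "L * K"] allI)
      fix x y
      have "norm (f (g x y)) \<le> norm (g x y) * K" by (rule K)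
      also have "\<dots> \<le> norm x * norm y * L * K" using L K by (intro mult_right_mono) auto
      finally show "norm (f (g x y)) \<le> norm x * norm y * (L * K)" by (simp add: mult.assoc)
    qed
  qed (simp_all add: f.add f.scaleR g.add_left g.add_right g.scaleR_left g.scaleR_right)
qed

lemma bounded_bilinear_matrix_vector_mult:
  "bounded_bilinear ((*v) :: 'k::{real_normed_field,euclidean_space}^'n^'m \<Rightarrow> _)"
proof -
  have "bilinear ((*v) :: 'k^'n^'m \<Rightarrow> _)"
    unfolding bilinear_def
    by (auto intro!: linearI simp: matrix_vector_mult_add_rdistrib matrix_vector_right_distrib
        matrix_vector_mult_def vec_eq_iff scaleR_sum_right
        distrib_right sum.distrib)
  then show ?thesis by (simp add: bilinear_conv_bounded_bilinear)
qed

text \<open>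
  A vector is the sum of its components along the axes, so that derivatives may be computed entrywise.
\<close>

lemma has_derivative_vec_lambda:
  fixes f :: "'a::real_normed_vector \<Rightarrow> 'n::finite \<Rightarrow> 'b::real_normed_vector"
  assumes "\<And>i. ((\<lambda>x. f x i) has_derivative (\<lambda>h. f' h i)) (at a)"
  shows "((\<lambda>x. \<chi> i. f x i) has_derivative (\<lambda>h. \<chi> i. f' h i)) (at a)"
proof -
  have e: "(\<chi> i. g i) = (\<Sum>i\<in>UNIV. axis i (g i))" for g :: "'n \<Rightarrow> 'b"
    by (auto simp: vec_eq_iff axis_def)
  have "bounded_linear (axis i :: 'b \<Rightarrow> 'b^'n)" for i
  proof (rule bounded_linear_intro[where K=1])
    fix x :: 'b
    have "(\<Sum>k\<in>UNIV. (norm (axis i x $ k))\<^sup>2) = (\<Sum>k\<in>UNIV. if k = i then (norm x)\<^sup>2 else 0)"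
      by (rule sum.cong) (auto simp: axis_def)
    then show "norm (axis i x) \<le> norm x * 1" by (simp add: norm_vec_def L2_set_def)
  qed (simp_all add: vec_eq_iff axis_def)
  then show ?thesis
    unfolding e[of "f _"] e[of "f' _"]
    by (intro has_derivative_sum bounded_linear.has_derivative[where f = "axis _"] assms)
qed

text \<open>
  \<open>j\<close> embeds the space as a direct summand of a coordinate space and \<open>r\<close> retracts onto it. Both are
  linear over the given scalars, so that matrices over them describe exactly the endomorphisms.
\<close>

locale coordinates = vector_space s
  for s :: "'k::{real_normed_field,euclidean_space} \<Rightarrow> 'v::real_normed_vector \<Rightarrow> 'v" +
  fixes j :: "'v \<Rightarrow> 'k^'n::finite" and r :: "'k^'n \<Rightarrow> 'v"
  assumes s_of_real: "s (of_real c) x = c *\<^sub>R x"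
    and j_linear: "linear_over s (*s) j" and r_linear: "linear_over (*s) s r"
    and r_j [simp]: "r (j x) = x"
    and j_bounded: "bounded_linear j" and r_bounded: "bounded_linear r"
begin

sublocale j: Vector_Spaces.linear s "(*s)" j by (rule j_linear)
sublocale r: Vector_Spaces.linear "(*s)" s r by (rule r_linear)

definition endo_of :: "'k^'n^'n \<Rightarrow> 'v \<Rightarrow> 'v"
  where "endo_of a x = r (a *v j x)"

definition matrix_of :: "('v \<Rightarrow> 'v) \<Rightarrow> 'k^'n^'n"
  where "matrix_of A = matrix (\<lambda>u. j (A (r u)))"

lemma linear_over_imp_linear:
  assumes "linear_over s s A" shows "linear A"
proof -
  interpret A: Vector_Spaces.linear s s A by fact
  show ?thesis by (rule linearI) (simp_all add: A.add A.scale flip: s_of_real)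
qed

lemma endo_of_endos: "endo_of a \<in> endos s"
proof -
  have "linear_over s s (r \<circ> ((*v) a \<circ> j))"
    by (intro Vector_Spaces.linear_compose[of _ "(*s)"] j_linear r_linear matrix_vector_mul_linear_gen)
  then show ?thesis by (simp add: endos_def endo_of_def[abs_def] comp_def)
qed

lemma endo_of_matrix_of:
  assumes "A \<in> endos s" shows "endo_of (matrix_of A) = A"
proof
  fix x
  have "linear_over (*s) (*s) (j \<circ> (A \<circ> r))"
    using assms unfolding endos_def mem_Collect_eq
    by (intro Vector_Spaces.linear_compose[of _ s] j_linear r_linear)
  then show "endo_of (matrix_of A) x = A x"
    by (simp add: endo_of_def matrix_of_def matrix_works comp_def)
qed

lemma endo_of_bounded_bilinear: "bounded_bilinear endo_of"
  unfolding endo_of_def[abs_def]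
  by (intro bounded_linear_comp_bounded_bilinear[OF r_bounded]
      bounded_bilinear.comp[OF bounded_bilinear_matrix_vector_mult bounded_linear_ident j_bounded])

sublocale endo_of: bounded_bilinear endo_of by (rule endo_of_bounded_bilinear)

lemma endo_of_minus: "endo_of (- a) = - endo_of a"
  by (simp add: fun_eq_iff endo_of.minus_left)

end

text \<open>
  A basis over the scalar field remains linearly independent over the reals, hence is at most as large
  as the real dimension and can be indexed by \<open>coord_index\<close>. Continuity of the coordinate map is the
  equivalence of norms in finite dimension: the norm of \<open>r u\<close> attains a positive minimum for \<open>u\<close> in the
  unit sphere of the range of \<open>j\<close>.
\<close>

lemma coordinates_exist:
  fixes s :: "'k::{real_normed_field,euclidean_space} \<Rightarrow> 'v::real_normed_vector \<Rightarrow> 'v"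
  assumes "fd_space s B"
  shows "\<exists>(j :: 'v \<Rightarrow> 'k^'v coord_index) r. coordinates s j r"
proof -
  interpret fd_space s B by fact
  have fin: "finite B" by (rule finite_Basis)
  have real_indep: "\<not> Real_Vector_Spaces.dependent B"
  proof (rule real_vector.independent_if_scalars_zero[OF fin])
    fix u x assume "(\<Sum>b\<in>B. u b *\<^sub>R b) = 0" "x \<in> B"
    then have "(\<Sum>b\<in>B. s (of_real (u b)) b) = 0" by (simp add: scale_of_real)
    then have "of_real (u x) = (0 :: 'k)"
      using \<open>x \<in> B\<close> by (rule independentD[OF independent_Basis fin subset_refl])
    then show "u x = 0" by simp
  qed
  define C where "C = (\<lambda>(k, b). s k b) ` (Basis \<times> B)"
  have "x \<in> Real_Vector_Spaces.span C" for x
  proof -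
    have "x \<in> span B" by (simp add: span_Basis)
    then have x: "x = (\<Sum>b\<in>B. s (representation B x b) b)"
      using sum_representation_eq[OF independent_Basis _ fin subset_refl] by simp
    have rep: "s c b = (\<Sum>k\<in>Basis. (c \<bullet> k) *\<^sub>R s k b)" for c b
    proof -
      have "s c b = s (\<Sum>k\<in>Basis. (c \<bullet> k) *\<^sub>R k) b" by (simp add: euclidean_representation)
      also have "\<dots> = (\<Sum>k\<in>Basis. s (of_real (c \<bullet> k)) (s k b))"
        by (simp add: scale_sum_left scaleR_conv_of_real)
      finally show ?thesis by (simp only: scale_of_real)
    qed
    have "(\<Sum>b\<in>B. \<Sum>k\<in>Basis. (representation B x b \<bullet> k) *\<^sub>R s k b) \<in> Real_Vector_Spaces.span C"
      by (intro real_vector.span_sum real_vector.span_scale real_vector.span_base)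
        (auto simp: C_def)
    then show ?thesis by (subst x) (simp add: rep[symmetric])
  qed
  then have C: "Real_Vector_Spaces.span C = UNIV" by blast
  obtain D where D: "D \<subseteq> C" "\<not> Real_Vector_Spaces.dependent D" "C \<subseteq> Real_Vector_Spaces.span D"
    using real_vector.maximal_independent_subset[of C] by metis
  have "Real_Vector_Spaces.span D = UNIV"
    using D(3) C by (metis UNIV_eq_I UNIV_I real_vector.span_minimal real_vector.subspace_span subsetD)
  then have dim: "Real_Vector_Spaces.dim (UNIV :: 'v set) = card D"
    using real_vector.basis_card_eq_dim[of D UNIV] D(2) by simp
  have finD: "finite D" using D(1) fin by (auto simp: C_def intro: finite_subset)
  have "card B \<le> card D"
    using real_vector.independent_span_bound[OF finD real_indep] \<open>Real_Vector_Spaces.span D = UNIV\<close> by simp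
  then have "card B \<le> CARD('v coord_index)" by (simp add: card_coord_index dim)
  then obtain \<phi> :: "'v \<Rightarrow> 'v coord_index" where \<phi>: "inj_on \<phi> B"
    using card_le_inj[OF fin finite] by blast
  define j :: "'v \<Rightarrow> 'k^'v coord_index" where
    "j = (\<lambda>x. \<chi> i. if i \<in> \<phi> ` B then representation B x (inv_into B \<phi> i) else 0)"
  define r :: "'k^'v coord_index \<Rightarrow> 'v" where "r = (\<lambda>u. \<Sum>b\<in>B. s (u $ \<phi> b) b)"
  have rj: "r (j x) = x" for x
  proof -
    have "r (j x) = (\<Sum>b\<in>B. s (representation B x b) b)"
      unfolding r_def j_def by (rule sum.cong) (auto simp: \<phi>)
    then show ?thesis
      using sum_representation_eq[OF independent_Basis _ fin subset_refl, of x] by (simp add: span_Basis)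
  qed
  have vs: "vector_space ((*s) :: 'k \<Rightarrow> 'k^'v coord_index \<Rightarrow> _)" ..
  have j_lin: "linear_over s (*s) j"
    unfolding Vector_Spaces.linear_iff using vs
    by (auto simp: j_def vec_eq_iff representation_add[OF independent_Basis]
        representation_scale[OF independent_Basis] span_Basis vector_space_axioms)
  have r_lin: "linear_over (*s) s r"
    unfolding Vector_Spaces.linear_iff using vs
    by (auto simp: r_def scale_left_distrib sum.distrib scale_sum_right vector_space_axioms)
  interpret j: Vector_Spaces.linear s "(*s)" j by (rule j_lin)
  interpret r: Vector_Spaces.linear "(*s)" s r by (rule r_lin)
  have scaleR_vec: "c *\<^sub>R u = of_real c *s u" for c and u :: "'k^'v coord_index"
    unfolding vec_eq_iff vector_scaleR_component vector_smult_component
    by (simp add: scaleR_conv_of_real)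
  have j_real: "linear j"
    by (rule linearI) (simp_all only: j.add j.scale scaleR_vec flip: scale_of_real)
  have "linear r"
    by (rule linearI) (simp_all only: r.add r.scale scaleR_vec scale_of_real)
  then have r_bounded: "bounded_linear r" by (simp add: linear_conv_bounded_linear)
  have "\<exists>K. \<forall>x. norm (j x) \<le> norm x * K"
  proof (cases "\<forall>x. j x = 0")
    case False
    define S where "S = sphere 0 1 \<inter> range j"
    have "closed (range j)"
      by (intro closed_subspace real_vector.linear_subspace_image[OF j_real]) simp
    then have "compact S" unfolding S_def by (intro compact_Int_closed compact_sphere)
    have normalized: "j x /\<^sub>R norm (j x) \<in> S" if "j x \<noteq> 0" for x
    proof -
      have "j x /\<^sub>R norm (j x) = j (x /\<^sub>R norm (j x))" by (simp add: linear_scale[OF j_real])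
      then have "j x /\<^sub>R norm (j x) \<in> range j" by (rule range_eqI)
      moreover have "norm (j x /\<^sub>R norm (j x)) = 1" using that by simp
      ultimately show ?thesis by (simp only: S_def Int_iff mem_sphere_0 simp_thms)
    qed
    then have "S \<noteq> {}" using False by blast
    then obtain u where u: "u \<in> S" "\<And>v. v \<in> S \<Longrightarrow> norm (r u) \<le> norm (r v)"
      using continuous_attains_inf[OF \<open>compact S\<close>, of "\<lambda>v. norm (r v)"]
        continuous_on_norm[OF linear_continuous_on[OF r_bounded]] by blast
    have "norm (r u) > 0"
    proof -
      obtain x where "u = j x" "norm u = 1" using u(1) by (auto simp: S_def)
      then have "x \<noteq> 0" using j.zero by fastforce
      then show ?thesis using \<open>u = j x\<close> rj by simp
    qed
    moreover have "norm (j x) \<le> norm x * inverse (norm (r u))" for x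
    proof (cases "j x = 0")
      case True
      then show ?thesis using \<open>norm (r u) > 0\<close> by simp
    next
      case nz: False
      have "norm (r u) \<le> norm (r (j x /\<^sub>R norm (j x)))" by (rule u(2)[OF normalized[OF nz]])
      also have "\<dots> = norm x / norm (j x)"
        by (simp add: linear_scale[OF \<open>linear r\<close>] rj divide_inverse mult.commute)
      finally show ?thesis using nz \<open>norm (r u) > 0\<close> by (simp add: field_simps)
    qed
    ultimately show ?thesis by blast
  qed (simp add: exI[of _ 0])
  then obtain K where "\<And>x. norm (j x) \<le> norm x * K" by blast
  then have j_bounded: "bounded_linear j"
    using j_real by (intro bounded_linear_intro[of j K]) (auto simp: linear_iff)
  have "coordinates s j r"
    using scale_of_real j_lin r_lin rj j_bounded r_bounded
    by (intro coordinates.intro coordinates_axioms.intro vector_space_axioms)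
  then show ?thesis by blast
qed

section \<open>The exponential of an endomorphism\<close>

lemma norm_funpow_le:
  fixes A :: "'v::real_normed_vector \<Rightarrow> 'v"
  assumes "\<And>x. norm (A x) \<le> H * norm x" and "H \<ge> 0"
  shows "norm ((A ^^ n) x) \<le> H ^ n * norm x"
proof (induction n)
  case (Suc n)
  have "norm ((A ^^ Suc n) x) \<le> H * norm ((A ^^ n) x)" using assms(1) by simp
  also have "\<dots> \<le> H * (H ^ n * norm x)" using Suc assms(2) by (intro mult_left_mono)
  finally show ?case by (simp add: mult.assoc)
qed simp

lemma norm_exp_term_le:
  fixes A :: "'v::real_normed_vector \<Rightarrow> 'v"
  assumes "\<And>x. norm (A x) \<le> H * norm x" and "H \<ge> 0"
  shows "norm ((A ^^ n) x /\<^sub>R fact n) \<le> (H ^ n /\<^sub>R fact n) * norm x"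
  using norm_funpow_le[OF assms, of n x] by (simp add: divide_simps mult.commute)

lemma linear_funpow:
  fixes A :: "'v::real_vector \<Rightarrow> 'v"
  assumes "linear A" shows "linear (A ^^ n)"
proof (induction n)
  case (Suc n)
  show ?case using linear_compose[OF Suc.IH assms] by (simp add: comp_def)
qed (simp add: linear_iff)

lemma funpow_uminus:
  fixes A :: "'v::real_vector \<Rightarrow> 'v"
  assumes "linear A" shows "((- A) ^^ n) x = (-1) ^ n *\<^sub>R (A ^^ n) x"
  by (induction n) (simp_all add: linear_scale[OF assms])

context coordinates begin

text \<open>
  The series converges absolutely in the coordinate space, which is complete, and \<open>r\<close> transports the
  limit back.
\<close>

lemma endo_exp_sums_if_bounded:
  fixes A :: "'v \<Rightarrow> 'v"
  assumes A: "\<And>x. norm (A x) \<le> H * norm x" and H: "H \<ge> 0"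
  shows "(\<lambda>n. (A ^^ n) v /\<^sub>R fact n) sums endo_exp A v"
proof -
  obtain K where K: "K \<ge> 0" "\<And>x. norm (j x) \<le> norm x * K"
    using bounded_linear.nonneg_bounded[OF j_bounded] by blast
  have "summable (\<lambda>n. j ((A ^^ n) v /\<^sub>R fact n))"
  proof (rule summable_comparison_test')
    show "summable (\<lambda>n. (H ^ n /\<^sub>R fact n) * norm v * K)"
      by (intro summable_mult2 summable_exp_generic)
    show "norm (j ((A ^^ n) v /\<^sub>R fact n)) \<le> (H ^ n /\<^sub>R fact n) * norm v * K" for n
      using norm_exp_term_le[OF A H, of n v] K by (meson mult_right_mono order_trans)
  qed
  from bounded_linear.summable[OF r_bounded this] show ?thesis
    by (simp add: endo_exp_def summable_sums)
qed

lemma endo_of_norm_bound: "\<exists>K\<ge>0. \<forall>a x. norm (endo_of a x) \<le> (norm a * K) * norm x"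
proof -
  obtain K where "K \<ge> 0" "\<And>a x. norm (endo_of a x) \<le> norm a * norm x * K"
    using endo_of.nonneg_bounded by blast
  then show ?thesis by (intro exI[of _ K]) (simp add: mult_ac)
qed

lemma endo_exp_sums:
  "(\<lambda>n. (endo_of a ^^ n) v /\<^sub>R fact n) sums endo_exp (endo_of a) v"
proof -
  obtain K where K: "K \<ge> 0" "\<And>a x. norm (endo_of a x) \<le> (norm a * K) * norm x"
    using endo_of_norm_bound by blast
  show ?thesis using K by (intro endo_exp_sums_if_bounded[of _ "norm a * K"]) auto
qed

text \<open>
  The exponential series converges uniformly on balls.
\<close>

lemma endo_exp_continuous: "continuous_on UNIV (\<lambda>a. endo_exp (endo_of a) v)"
proof -
  obtain K where K: "K \<ge> 0" "\<And>a x. norm (endo_of a x) \<le> (norm a * K) * norm x"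
    using endo_of_norm_bound by blast
  obtain L where L: "L \<ge> 0" "\<And>x. norm (j x) \<le> norm x * L"
    using bounded_linear.nonneg_bounded[OF j_bounded] by blast
  define t where "t = (\<lambda>n a. j ((endo_of a ^^ n) v /\<^sub>R fact n))"
  have exp_t: "endo_exp (endo_of a) v = r (\<Sum>n. t n a)" for a
    unfolding t_def using sums_unique[OF bounded_linear.sums[OF j_bounded endo_exp_sums[of a v]]]
    by (metis r_j)
  have pow: "continuous_on UNIV (\<lambda>a. (endo_of a ^^ n) v)" for n
    by (induction n) (auto intro!: endo_of.continuous_on continuous_on_id)
  have "continuous_on (ball 0 R) (\<lambda>a. \<Sum>n. t n a)" if R: "R > 0" for R
  proof (rule uniform_limit_theorem)
    show "uniform_limit (ball 0 R) (\<lambda>n a. \<Sum>i<n. t i a) (\<lambda>a. \<Sum>n. t n a) sequentially"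
    proof (rule Weierstrass_m_test)
      show "summable (\<lambda>n. ((R * K) ^ n /\<^sub>R fact n) * norm v * L)"
        by (intro summable_mult2 summable_exp_generic)
      fix n a assume a: "a \<in> ball (0 :: 'k^'n^'n) R"
      have "norm (endo_of a x) \<le> (R * K) * norm x" for x
        using a by (intro order_trans[OF K(2)] mult_right_mono K) auto
      then have "norm ((endo_of a ^^ n) v /\<^sub>R fact n) \<le> ((R * K) ^ n /\<^sub>R fact n) * norm v"
        using R K by (intro norm_exp_term_le) auto
      then show "norm (t n a) \<le> ((R * K) ^ n /\<^sub>R fact n) * norm v * L"
        unfolding t_def using L by (meson mult_right_mono order_trans)
    qed
    show "\<forall>\<^sub>F n in sequentially. continuous_on (ball 0 R) (\<lambda>a. \<Sum>i<n. t i a)"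
      unfolding t_def
      by (intro always_eventually allI continuous_on_sum bounded_linear.continuous_on[OF j_bounded]
          continuous_intros continuous_on_subset[OF pow]) auto
  qed simp
  then have "continuous_on (\<Union>R\<in>{0<..}. ball 0 R) (\<lambda>a. \<Sum>n. t n a)"
    by (intro continuous_on_open_UN) auto
  moreover have "(\<Union>R\<in>{0<..}. ball 0 R) = (UNIV :: ('k^'n^'n) set)"
  proof (intro equalityI subsetI)
    fix a :: "'k^'n^'n"
    show "a \<in> (\<Union>R\<in>{0<..}. ball 0 R)"
      by (rule UN_I[of "norm a + 1"]) (auto simp: add_nonneg_pos)
  qed simp
  ultimately show ?thesis
    unfolding exp_t by (auto intro: bounded_linear.continuous_on[OF r_bounded])
qed

lemma endo_exp_remainder:
  fixes A :: "'v \<Rightarrow> 'v"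
  assumes A: "\<And>x. norm (A x) \<le> H * norm x" and H: "H \<ge> 0"
  shows "norm (endo_exp A v - v - A v) \<le> H\<^sup>2 * exp H * norm v"
proof -
  have "(\<lambda>n. (A ^^ (n + 2)) v /\<^sub>R fact (n + 2)) sums
      (endo_exp A v - (\<Sum>i<2. (A ^^ i) v /\<^sub>R fact i))"
    by (rule sums_split_initial_segment[OF endo_exp_sums_if_bounded[OF A H]])
  then have rem: "(\<lambda>n. (A ^^ (n + 2)) v /\<^sub>R fact (n + 2)) sums (endo_exp A v - v - A v)"
    by (simp add: numeral_2_eq_2 diff_diff_eq)
  have bound: "(\<lambda>n. H\<^sup>2 * (H ^ n /\<^sub>R fact n) * norm v) sums (H\<^sup>2 * exp H * norm v)"
    by (intro sums_mult sums_mult2 exp_converges)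
  have "norm (\<Sum>i<n. (A ^^ (i + 2)) v /\<^sub>R fact (i + 2)) \<le> H\<^sup>2 * exp H * norm v" for n
  proof -
    have "norm (\<Sum>i<n. (A ^^ (i + 2)) v /\<^sub>R fact (i + 2))
        \<le> (\<Sum>i<n. H\<^sup>2 * (H ^ i /\<^sub>R fact i) * norm v)"
    proof (rule sum_norm_le)
      fix i
      have "norm ((A ^^ (i + 2)) v /\<^sub>R fact (i + 2)) \<le> (H ^ (i + 2) / fact (i + 2)) * norm v"
        using norm_exp_term_le[OF A H, of "i + 2" v] by (simp add: divide_inverse mult.commute)
      also have "\<dots> \<le> (H ^ (i + 2) / fact i) * norm v"
        using H by (intro mult_right_mono divide_left_mono fact_mono) auto
      also have "\<dots> = H\<^sup>2 * (H ^ i /\<^sub>R fact i) * norm v"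
        by (simp add: power_add divide_inverse power2_eq_square)
      finally show "norm ((A ^^ (i + 2)) v /\<^sub>R fact (i + 2)) \<le> H\<^sup>2 * (H ^ i /\<^sub>R fact i) * norm v" .
    qed
    also have "\<dots> \<le> H\<^sup>2 * exp H * norm v"
      using sum_le_suminf[OF sums_summable[OF bound], of "{..<n}"] sums_unique[OF bound] H by auto
    finally show ?thesis .
  qed
  with rem show ?thesis
    unfolding sums_def by (intro tendsto_upperbound[OF tendsto_norm]) auto
qed

lemma endo_exp_has_derivative:
  "((\<lambda>a. endo_exp (endo_of a) v) has_derivative (\<lambda>a. endo_of a v)) (at 0)"
proof -
  obtain K where K: "K \<ge> 0" "\<And>a x. norm (endo_of a x) \<le> (norm a * K) * norm x"
    using endo_of_norm_bound by blast
  have exp0: "endo_exp (endo_of 0) v = v"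
    using endo_exp_remainder[of "endo_of 0" 0 v] by (simp add: endo_of.zero_left)
  show ?thesis
  proof (rule has_derivativeI_sandwich[of 1 _ _ _ _ "\<lambda>a. norm a * (K\<^sup>2 * exp (norm a * K) * norm v)"])
    show "bounded_linear (\<lambda>a. endo_of a v)" by (rule endo_of.bounded_linear_left)
    have "((\<lambda>a::'k^'n^'n. norm a * (K\<^sup>2 * exp (norm a * K) * norm v)) \<longlongrightarrow>
        norm (0::'k^'n^'n) * (K\<^sup>2 * exp (norm (0::'k^'n^'n) * K) * norm v)) (at 0)"
      by (intro tendsto_intros)
    then show "((\<lambda>a::'k^'n^'n. norm a * (K\<^sup>2 * exp (norm a * K) * norm v)) \<longlongrightarrow> 0) (at 0)" by simp
    fix a :: "'k^'n^'n" assume "a \<noteq> 0"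
    have "norm (endo_exp (endo_of a) v - v - endo_of a v)
        \<le> (norm a * K)\<^sup>2 * exp (norm a * K) * norm v"
      using K by (intro endo_exp_remainder) auto
    then show "norm (endo_exp (endo_of a) v - endo_exp (endo_of 0) v - endo_of (a - 0) v) / norm (a - 0)
        \<le> norm a * (K\<^sup>2 * exp (norm a * K) * norm v)"
      using \<open>a \<noteq> 0\<close> by (simp add: exp0 divide_simps power2_eq_square mult_ac)
  qed simp
qed

text \<open>
  This is the Cauchy product of the two exponential series. Its triangular partial sums are equal to
  \<open>v\<close>, because their coefficients are those of \<open>exp (-1 + 1)\<close>; its square partial sums converge to the
  left-hand side. The difference of the two is bounded by the corresponding difference for the real
  series of \<open>exp H * exp H\<close>, which tends to \<open>0\<close>.
\<close>

lemma endo_exp_minus_inverse: "endo_exp (- endo_of a) (endo_exp (endo_of a) v) = v"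
proof -
  define A where "A = endo_of a"
  obtain K where K: "K \<ge> 0" "\<And>a x. norm (endo_of a x) \<le> (norm a * K) * norm x"
    using endo_of_norm_bound by blast
  define H where "H = norm a * K"
  have H: "H \<ge> 0" and A: "\<And>x. norm (A x) \<le> H * norm x" using K by (simp_all add: A_def H_def)
  then have A': "\<And>x. norm ((- A) x) \<le> H * norm x" by simp
  have lin: "linear A" using endo_of_endos linear_over_imp_linear unfolding A_def endos_def by blast
  \<comment> \<open>The terms of the double series, their majorants, and the two ways of exhausting the index set.\<close>
  define u where "u = (\<lambda>(i, k). ((- A) ^^ i) ((A ^^ k) v /\<^sub>R fact k) /\<^sub>R fact i)"
  define x where "x = (\<lambda>(i, k). (H ^ i /\<^sub>R fact i) * (H ^ k /\<^sub>R fact k) * norm v)"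
  define Sq where "Sq = (\<lambda>n. {..<n} \<times> {..<n::nat})"
  define Tr where "Tr = (\<lambda>n. {(i, k). i + k < (n::nat)})"
  have fin: "finite (Sq n)" "Tr n \<subseteq> Sq n" for n unfolding Sq_def Tr_def by auto
  have u_eq: "u (i, k) = ((-1) ^ i /\<^sub>R fact i * (1 ^ k /\<^sub>R fact k)) *\<^sub>R (A ^^ (i + k)) v" for i k
    by (simp add: u_def funpow_uminus[OF lin] funpow_add linear_scale[OF linear_funpow[OF lin]]
        linear_neg[OF linear_funpow[OF lin]] mult_ac)
  have ux: "norm (u p) \<le> x p" for p
  proof (cases p)
    case (Pair i k)
    have "norm (u p) = norm ((A ^^ (i + k)) v) / (fact i * fact k)"
      by (simp add: Pair u_eq abs_mult power_abs divide_inverse mult_ac)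
    also have "\<dots> \<le> H ^ (i + k) * norm v / (fact i * fact k)"
      by (intro divide_right_mono norm_funpow_le A H) auto
    finally show ?thesis by (simp add: Pair x_def power_add divide_inverse mult_ac)
  qed
  have x_tri: "sum x (Tr n) = (\<Sum>m<n. ((H + H) ^ m /\<^sub>R fact m)) * norm v" for n
  proof -
    have "sum x (Tr n) = (\<Sum>m<n. \<Sum>i\<le>m. x (i, m - i))"
      unfolding Tr_def using sum.triangle_reindex[of "\<lambda>i k. x (i, k)" n] by simp
    also have "\<dots> = (\<Sum>m<n. ((H + H) ^ m /\<^sub>R fact m)) * norm v"
      unfolding exp_series_add_commuting[of H H, OF refl] by (simp add: x_def sum_distrib_right)
    finally show ?thesis .
  qed
  have u_tri: "sum u (Tr (Suc n)) = v" for n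
  proof -
    have "sum u (Tr (Suc n)) = (\<Sum>m<Suc n. \<Sum>i\<le>m. u (i, m - i))"
      unfolding Tr_def using sum.triangle_reindex[of "\<lambda>i k. u (i, k)" "Suc n"] by simp
    also have "\<dots> = (\<Sum>m<Suc n. ((-1 + 1) ^ m /\<^sub>R fact m) *\<^sub>R (A ^^ m) v)"
    proof (rule sum.cong[OF refl])
      fix m
      have "(\<Sum>i\<le>m. u (i, m - i)) =
          (\<Sum>i\<le>m. ((-1) ^ i /\<^sub>R fact i * (1 ^ (m - i) /\<^sub>R fact (m - i)))) *\<^sub>R (A ^^ m) v"
        unfolding scaleR_sum_left by (rule sum.cong) (simp_all add: u_eq)
      then show "(\<Sum>i\<le>m. u (i, m - i)) = ((-1 + 1) ^ m /\<^sub>R fact m) *\<^sub>R (A ^^ m) v"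
        using exp_series_add_commuting[of "-1::real" 1 m] by simp
    qed
    also have "\<dots> = (\<Sum>m<Suc n. if m = 0 then v else 0)"
      by (intro sum.cong) (auto simp: power_0_left)
    finally show ?thesis by simp
  qed
  have x_sq: "sum x (Sq n) = (\<Sum>i<n. H ^ i /\<^sub>R fact i) * (\<Sum>i<n. H ^ i /\<^sub>R fact i) * norm v" for n
    unfolding Sq_def x_def sum_product sum.cartesian_product
    by (simp add: sum_distrib_right case_prod_unfold)
  define p where "p = (\<lambda>B n w. \<Sum>i<n. ((B :: 'v \<Rightarrow> 'v) ^^ i) w /\<^sub>R fact i)"
  have lin': "linear ((- A) ^^ i)" for i
    by (intro linear_funpow) (use lin in \<open>simp add: linear_iff\<close>)
  have u_sq: "sum u (Sq n) = p (- A) n (p A n v)" for n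
    unfolding Sq_def u_def p_def linear_sum[OF lin'] scaleR_sum_right sum.cartesian_product ..
  have le: "norm (sum u (Sq n) - sum u (Tr n)) \<le> sum x (Sq n) - sum x (Tr n)" for n
  proof -
    have "sum u (Sq n) - sum u (Tr n) = sum u (Sq n - Tr n)"
      by (rule sum_diff[OF fin, symmetric])
    moreover have "norm (sum u (Sq n - Tr n)) \<le> sum x (Sq n - Tr n)" by (rule sum_norm_le[OF ux])
    moreover have "sum x (Sq n) - sum x (Tr n) = sum x (Sq n - Tr n)"
      by (rule sum_diff[OF fin, symmetric])
    ultimately show ?thesis by simp
  qed
  have "(\<lambda>n. sum x (Sq n) - sum x (Tr n)) \<longlonglongrightarrow>
      exp H * exp H * norm v - exp (H + H) * norm v"
    unfolding x_sq x_tri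
    by (intro tendsto_intros exp_converges[unfolded sums_def])
  then have "(\<lambda>n. sum x (Sq n) - sum x (Tr n)) \<longlonglongrightarrow> 0"
    by (simp only: exp_add diff_self)
  then have "(\<lambda>n. sum u (Sq n) - sum u (Tr n)) \<longlonglongrightarrow> 0"
    by (rule Lim_null_comparison[OF always_eventually[OF allI[OF le]]])
  then have "(\<lambda>n. sum u (Sq (Suc n)) - v) \<longlonglongrightarrow> 0"
    by (drule_tac LIMSEQ_Suc) (simp only: u_tri)
  then have "(\<lambda>n. p (- A) (Suc n) (p A (Suc n) v)) \<longlonglongrightarrow> v"
    unfolding u_sq by (rule LIM_zero_cancel)
  then have lim_v: "(\<lambda>n. p (- A) n (p A n v)) \<longlonglongrightarrow> v"
    by (rule LIMSEQ_imp_Suc)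
  define w where "w = endo_exp A v"
  have pw: "(\<lambda>n. p A n v - w) \<longlonglongrightarrow> 0"
    using endo_exp_sums_if_bounded[OF A H, of v] unfolding sums_def p_def w_def by (simp add: LIM_zero)
  have le_exp: "norm (p (- A) n y) \<le> exp H * norm y" for n y
  proof -
    have "norm (p (- A) n y) \<le> (\<Sum>i<n. (H ^ i /\<^sub>R fact i) * norm y)"
      unfolding p_def by (intro sum_norm_le norm_exp_term_le A' H)
    also have "\<dots> \<le> exp H * norm y"
      unfolding sum_distrib_right[symmetric] exp_def
      using H by (intro mult_right_mono sum_le_suminf summable_exp_generic) auto
    finally show ?thesis .
  qed
  have "(\<lambda>n. p (- A) n (p A n v - w)) \<longlonglongrightarrow> 0"
    using tendsto_mult_right_zero[OF tendsto_norm_zero[OF pw]]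
    by (rule Lim_null_comparison[OF always_eventually[OF allI[OF le_exp]]])
  moreover have "(\<lambda>n. p (- A) n w) \<longlonglongrightarrow> endo_exp (- A) w"
    using endo_exp_sums_if_bounded[OF A' H, of w] unfolding sums_def p_def by simp
  ultimately have "(\<lambda>n. p (- A) n (p A n v - w) + p (- A) n w) \<longlonglongrightarrow> 0 + endo_exp (- A) w"
    by (rule tendsto_add)
  moreover have "p (- A) n (p A n v - w) + p (- A) n w = p (- A) n (p A n v)" for n
    unfolding p_def by (simp add: linear_diff[OF lin'] scaleR_diff_right flip: sum.distrib)
  ultimately show ?thesis
    using LIMSEQ_unique[OF lim_v, of "endo_exp (- A) w"] by (simp add: w_def A_def)
qed

end

section \<open>Alternating maps and brackets in low degrees\<close>

lemma shuffle_sets_1_1: "shuffle_sets 1 1 = {{0}, {1}}"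
proof -
  have "S \<in> shuffle_sets 1 1 \<longleftrightarrow> S = {0} \<or> S = {1}" for S
  proof
    assume "S \<in> shuffle_sets 1 1"
    then have "S \<subseteq> {0, 1}" "card S = 1" by (auto simp: shuffle_sets_def)
    then show "S = {0} \<or> S = {1}" by (auto simp: card_1_singleton_iff)
  qed (auto simp: shuffle_sets_def)
  then show ?thesis by blast
qed

lemma shuffle_sets_full: "shuffle_sets p 0 = {{..<p}}"
  by (auto simp: shuffle_sets_def intro: card_subset_eq dest!: card_subset_eq[rotated])

lemma shuffle_sets_2_1: "shuffle_sets 2 1 = {{0, 1}, {0, 2}, {1, 2}}"
proof -
  have "S \<in> shuffle_sets 2 1 \<longleftrightarrow> S = {0, 1} \<or> S = {0, 2} \<or> S = {1, 2}" for S
  proof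
    assume "S \<in> shuffle_sets 2 1"
    then have S: "S \<subseteq> {0, 1, 2}" "card S = 2" by (auto simp: shuffle_sets_def)
    then obtain a b where "S = {a, b}" "a \<noteq> b" by (auto simp: card_2_iff)
    with S(1) show "S = {0, 1} \<or> S = {0, 2} \<or> S = {1, 2}" by auto
  qed (auto simp: shuffle_sets_def)
  then show ?thesis by blast
qed

lemma shuffle_signs:
  "shuffle_sign {0} = 1" "shuffle_sign {Suc 0} = -1"
  "shuffle_sign {..<p} = 1"
  "shuffle_sign {0, Suc 0} = 1" "shuffle_sign {0, 2} = -1" "shuffle_sign {Suc 0, 2} = 1"
proof -
  have e: "{(i, k). i \<in> {0} \<and> k \<notin> {0} \<and> k < (i::nat)} = {}"
    "{(i, k). i \<in> {Suc 0} \<and> k \<notin> {Suc 0} \<and> k < i} = {(1, 0)}"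
    "{(i, k). i \<in> {..<p} \<and> k \<notin> {..<p} \<and> k < i} = {}"
    "{(i, k). i \<in> {0, Suc 0} \<and> k \<notin> {0, Suc 0} \<and> k < i} = {}"
    "{(i, k). i \<in> {0, 2} \<and> k \<notin> {0, 2} \<and> k < (i::nat)} = {(2, 1)}"
    "{(i, k). i \<in> {Suc 0, 2} \<and> k \<notin> {Suc 0, 2} \<and> k < i} = {(1, 0), (2, 0)}"
    by auto
  show "shuffle_sign {0} = 1" "shuffle_sign {Suc 0} = -1"
    "shuffle_sign {..<p} = 1"
    "shuffle_sign {0, Suc 0} = 1" "shuffle_sign {0, 2} = -1" "shuffle_sign {Suc 0, 2} = 1"
    unfolding shuffle_sign_def e by auto
qed

lemma shuffle_sets_Suc:
  "shuffle_sets (Suc 0) (Suc 0) = {{0}, {Suc 0}}"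
  "shuffle_sets (Suc (Suc 0)) (Suc 0) = {{0, Suc 0}, {0, Suc (Suc 0)}, {Suc 0, Suc (Suc 0)}}"
  using shuffle_sets_1_1 shuffle_sets_2_1 by (simp_all add: numeral_2_eq_2)

lemma nr_insert_1_1:
  "nr_insert 1 1 P Q [x, y, z] = P [Q [x, y], z] - P [Q [x, z], y] + P [Q [y, z], x]"
  by (simp add: nr_insert_def shuffle_sets_Suc shuffle_signs[unfolded numeral_2_eq_2] nths_Cons doubleton_eq_iff
     )

lemma nr_insert_1_0: "nr_insert 1 0 P Q [x, y] = P [Q [x], y] - P [Q [y], x]"
  by (simp add: nr_insert_def shuffle_sets_Suc shuffle_signs nths_Cons)

lemma nr_insert_0_1: "nr_insert 0 1 P Q [x, y] = P [Q [x, y]]"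
  by (simp add: nr_insert_def shuffle_sets_full shuffle_signs nths_Cons numeral_2_eq_2)

definition alt_bilinear ::
    "('k::field \<Rightarrow> 'v::ab_group_add \<Rightarrow> 'v) \<Rightarrow> ('k \<Rightarrow> 'w::ab_group_add \<Rightarrow> 'w) \<Rightarrow> ('v \<Rightarrow> 'v \<Rightarrow> 'w) \<Rightarrow> bool"
  where "alt_bilinear s t b \<longleftrightarrow>
    (\<forall>x. linear_over s t (\<lambda>y. b x y)) \<and> (\<forall>y. linear_over s t (\<lambda>x. b x y)) \<and> (\<forall>x. b x x = 0)"

lemma linear_over_simps:
  assumes "linear_over s t a"
  shows "a (x + y) = a x + a y" "a (x - y) = a x - a y" "a 0 = 0" "a (- x) = - a x"
    "a (s c x) = t c (a x)"
proof -
  interpret Vector_Spaces.linear s t a by fact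
  show "a (x + y) = a x + a y" "a (x - y) = a x - a y" "a 0 = 0" "a (- x) = - a x"
    "a (s c x) = t c (a x)" by (simp_all add: add diff neg scale)
qed

lemma alt_bilinear_simps:
  assumes "alt_bilinear s t b"
  shows "b (x + x') y = b x y + b x' y" "b x (y + y') = b x y + b x y'"
    "b (x - x') y = b x y - b x' y" "b x (y - y') = b x y - b x y'"
    "b (- x) y = - b x y" "b x (- y) = - b x y"
    "b 0 y = 0" "b x 0 = 0" "b (s c x) y = t c (b x y)" "b x (s c y) = t c (b x y)" "b x x = 0"
  using assms linear_over_simps[of s t "\<lambda>x. b x y"] linear_over_simps[of s t "\<lambda>y. b x y"]
  unfolding alt_bilinear_def by auto

lemma alt_bilinear_swap:
  assumes "alt_bilinear s t b" shows "b y x = - b x y"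
proof -
  have "b (x + y) (x + y) = 0" using alt_bilinear_simps(11)[OF assms] .
  then have "b x x + b y x + (b x y + b y y) = 0"
    unfolding alt_bilinear_simps(1,2)[OF assms] .
  then have "b y x + b x y = 0" by (simp add: alt_bilinear_simps(11)[OF assms])
  then show ?thesis by (simp add: eq_neg_iff_add_eq_0)
qed

lemma alt_bilinear_of_alt_maps:
  assumes P: "P \<in> alt_maps s t 2" shows "alt_bilinear s t (\<lambda>x y. P [x, y])"
proof -
  have lin: "linear_over s t (\<lambda>v. P (xs[i := v]))" if "length xs = 2" "i < 2" for xs i
    using P that unfolding alt_maps_def by blast
  have zero: "P [x, x] = 0" for x
  proof -
    have "length [x, x] = 2 \<and> 0 < (1::nat) \<and> (1::nat) < 2 \<and> [x, x] ! 0 = [x, x] ! 1" by simp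
    then show ?thesis using P unfolding alt_maps_def by blast
  qed
  show ?thesis
    unfolding alt_bilinear_def
    using lin[of "[x, undefined]" 1 for x] lin[of "[undefined, x]" 0 for x] zero by auto
qed

lemma bin_cochain_alt_maps:
  assumes b: "alt_bilinear s t b" shows "bin_cochain b \<in> alt_maps s t 2"
  unfolding alt_maps_def mem_Collect_eq
proof (intro conjI allI impI)
  fix xs :: "'b list" assume "length xs \<noteq> 2"
  then show "bin_cochain b xs = 0"
    by (auto simp: bin_cochain_def split: list.split)
next
  fix xs :: "'b list" and i :: nat assume "length xs = 2 \<and> i < 2"
  moreover from this obtain x y where "xs = [x, y]"
    by (auto simp: numeral_2_eq_2 length_Suc_conv)
  moreover have "i = 0 \<or> i = 1" using calculation(1) by auto
  ultimately show "linear_over s t (\<lambda>v. bin_cochain b (xs[i := v]))"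
    using b by (auto simp: bin_cochain_def alt_bilinear_def)
next
  fix xs :: "'b list" and i k :: nat assume "length xs = 2 \<and> i < k \<and> k < 2 \<and> xs ! i = xs ! k"
  then obtain x where "xs = [x, x]"
    by (auto simp: numeral_2_eq_2 length_Suc_conv less_Suc_eq nth_Cons')
  then show "bin_cochain b xs = 0" using b by (simp add: bin_cochain_def alt_bilinear_def)
qed

lemma alt_maps_3I:
  fixes P :: "'b::ab_group_add list \<Rightarrow> 'c::ab_group_add"
  assumes len: "\<And>xs. length xs \<noteq> 3 \<Longrightarrow> P xs = 0"
    and lin: "\<And>y z. linear_over s t (\<lambda>x. P [x, y, z])" "\<And>x z. linear_over s t (\<lambda>y. P [x, y, z])"
      "\<And>x y. linear_over s t (\<lambda>z. P [x, y, z])"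
    and alt: "\<And>x y. P [x, x, y] = 0" "\<And>x y. P [x, y, x] = 0" "\<And>x y. P [y, x, x] = 0"
  shows "P \<in> alt_maps s t 3"
  unfolding alt_maps_def mem_Collect_eq
proof (intro conjI allI impI)
  fix xs :: "'b list" and i :: nat assume "length xs = 3 \<and> i < 3"
  moreover from this obtain x y z where "xs = [x, y, z]"
    by (auto simp: numeral_3_eq_3 length_Suc_conv)
  moreover have "i = 0 \<or> i = 1 \<or> i = 2" using calculation(1) by auto
  ultimately show "linear_over s t (\<lambda>v. P (xs[i := v]))"
    using lin by (auto simp: numeral_2_eq_2)
next
  fix xs :: "'b list" and i k :: nat assume "length xs = 3 \<and> i < k \<and> k < 3 \<and> xs ! i = xs ! k"
  then obtain x y z where "xs = [x, y, z]" "x = y \<or> x = z \<or> y = z"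
    by (auto simp: numeral_3_eq_3 length_Suc_conv less_Suc_eq)
  then show "P xs = 0" using alt by auto
qed (rule len)

text \<open>
  This is the Nijenhuis--Richardson bracket of two elements of degree one. For \<open>b = c\<close> alternating it
  is, up to the factor \<open>- 2\<close>, the Jacobiator.
\<close>

definition polarized_jacobiator ::
    "('v \<Rightarrow> 'v \<Rightarrow> 'v) \<Rightarrow> ('v \<Rightarrow> 'v \<Rightarrow> 'v) \<Rightarrow> 'v \<Rightarrow> 'v \<Rightarrow> 'v \<Rightarrow> 'v::ab_group_add"
  where "polarized_jacobiator b c x y z =
    (b (c x y) z - b (c x z) y + b (c y z) x) + (c (b x y) z - c (b x z) y + c (b y z) x)"

text \<open>
  The Chevalley--Eilenberg differential of a one-cochain with adjoint coefficients, which is also the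
  bracket of \<open>b\<close> with an element of degree zero.
\<close>

definition coboundary ::
    "('v \<Rightarrow> 'v \<Rightarrow> 'v) \<Rightarrow> ('v \<Rightarrow> 'v) \<Rightarrow> 'v \<Rightarrow> 'v \<Rightarrow> 'v::ab_group_add"
  where "coboundary b a x y = b (a x) y + b x (a y) - a (b x y)"

lemma nr_bracket_1_1:
  "nr_bracket 1 1 P Q [x, y, z] =
    polarized_jacobiator (\<lambda>x y. P [x, y]) (\<lambda>x y. Q [x, y]) x y z"
  using nr_insert_1_1[of P Q x y z] nr_insert_1_1[of Q P x y z]
  by (simp add: nr_bracket_def polarized_jacobiator_def)

lemma nr_bracket_1_0:
  assumes "alt_bilinear s t b"
  shows "nr_bracket 1 0 (bin_cochain b) P [x, y] = coboundary b (\<lambda>x. P [x]) x y"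
  using nr_insert_1_0[of "bin_cochain b" P x y] nr_insert_0_1[of P "bin_cochain b" x y]
  by (simp add: nr_bracket_def coboundary_def bin_cochain_def alt_bilinear_swap[OF assms, of x])

lemma (in vector_space) linear_over_closed:
  assumes "linear_over scale scale f" "linear_over scale scale g"
  shows "linear_over scale scale (\<lambda>x. f x + g x)" "linear_over scale scale (\<lambda>x. f x - g x)"
    "linear_over scale scale (\<lambda>x. f (g x))"
proof -
  interpret f: Vector_Spaces.linear scale scale f by fact
  interpret g: Vector_Spaces.linear scale scale g by fact
  show "linear_over scale scale (\<lambda>x. f x + g x)" "linear_over scale scale (\<lambda>x. f x - g x)"
    "linear_over scale scale (\<lambda>x. f (g x))"
    by (unfold_locales; simp add: f.add g.add f.scale g.scale scale_right_distrib
        scale_right_diff_distrib)+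
qed

lemma (in vector_space) zero_alt_maps: "0 \<in> alt_maps scale scale n"
proof -
  have "linear_over scale scale (\<lambda>v. 0)" by unfold_locales simp_all
  then show ?thesis by (simp add: alt_maps_def)
qed

lemma (in vector_space) add_alt_maps:
  assumes "P \<in> alt_maps scale scale n" "Q \<in> alt_maps scale scale n"
  shows "P + Q \<in> alt_maps scale scale n"
  using assms linear_over_closed(1) by (simp add: alt_maps_def)

lemma (in vector_space) diff_alt_maps:
  assumes "P \<in> alt_maps scale scale n" "Q \<in> alt_maps scale scale n"
  shows "P - Q \<in> alt_maps scale scale n"
  using assms linear_over_closed(2) by (simp add: alt_maps_def)

lemma polarized_jacobiator_linear:
  assumes "vector_space s" and b: "alt_bilinear s s b" and c: "alt_bilinear s s c"
  shows "linear_over s s (\<lambda>x. polarized_jacobiator b c x y z)"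
    "linear_over s s (\<lambda>y. polarized_jacobiator b c x y z)"
    "linear_over s s (\<lambda>z. polarized_jacobiator b c x y z)"
proof -
  interpret vector_space s by fact
  have lb: "linear_over s s (b x)" "linear_over s s (\<lambda>x. b x y)" for x y
    using b by (auto simp: alt_bilinear_def)
  have lc: "linear_over s s (c x)" "linear_over s s (\<lambda>x. c x y)" for x y
    using c by (auto simp: alt_bilinear_def)
  note lin = linear_over_closed(1)[OF linear_over_closed(1)[OF linear_over_closed(2)]
      linear_over_closed(1)[OF linear_over_closed(2)]]
  note comp = linear_over_closed(3)
  show "linear_over s s (\<lambda>x. polarized_jacobiator b c x y z)"
    unfolding polarized_jacobiator_def
    by (rule lin[OF comp[OF lb(2) lc(2)] comp[OF lb(2) lc(2)] lb(1)
          comp[OF lc(2) lb(2)] comp[OF lc(2) lb(2)] lc(1)])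
  show "linear_over s s (\<lambda>y. polarized_jacobiator b c x y z)"
    unfolding polarized_jacobiator_def
    by (rule lin[OF comp[OF lb(2) lc(1)] lb(1) comp[OF lb(2) lc(2)]
          comp[OF lc(2) lb(1)] lc(1) comp[OF lc(2) lb(2)]])
  show "linear_over s s (\<lambda>z. polarized_jacobiator b c x y z)"
    unfolding polarized_jacobiator_def
    by (rule lin[OF lb(1) comp[OF lb(2) lc(1)] comp[OF lb(2) lc(1)]
          lc(1) comp[OF lc(2) lb(1)] comp[OF lc(2) lb(1)]])
qed

lemma nr_bracket_1_1_alt_maps:
  fixes s :: "'k::field \<Rightarrow> 'v::real_vector \<Rightarrow> 'v"
  assumes s: "vector_space s" and P: "P \<in> alt_maps s s 2" and Q: "Q \<in> alt_maps s s 2"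
  shows "nr_bracket 1 1 P Q \<in> alt_maps s s 3"
proof (rule alt_maps_3I)
  define b where "b = (\<lambda>x y. P [x, y])"
  define c where "c = (\<lambda>x y. Q [x, y])"
  have b: "alt_bilinear s s b" and c: "alt_bilinear s s c"
    using P Q alt_bilinear_of_alt_maps by (auto simp: b_def c_def)
  note bracket = nr_bracket_1_1[of P Q, folded b_def c_def]
  note lin = polarized_jacobiator_linear[OF s b c]
  note swap = alt_bilinear_swap[OF b] alt_bilinear_swap[OF c]
  note simps = alt_bilinear_simps(5-8,11)[OF b] alt_bilinear_simps(5-8,11)[OF c]
  show "nr_bracket 1 1 P Q xs = 0" if "length xs \<noteq> 3" for xs
    using that by (simp add: nr_bracket_def nr_insert_def)
  show "linear_over s s (\<lambda>x. nr_bracket 1 1 P Q [x, y, z])" for y z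
    unfolding bracket by (rule lin)
  show "linear_over s s (\<lambda>y. nr_bracket 1 1 P Q [x, y, z])" for x z
    unfolding bracket by (rule lin)
  show "linear_over s s (\<lambda>z. nr_bracket 1 1 P Q [x, y, z])" for x y
    unfolding bracket by (rule lin)
  show "nr_bracket 1 1 P Q [x, x, y] = 0" "nr_bracket 1 1 P Q [y, x, x] = 0" for x y
    unfolding bracket polarized_jacobiator_def by (simp_all add: simps)
  show "nr_bracket 1 1 P Q [x, y, x] = 0" for x y
    unfolding bracket polarized_jacobiator_def by (simp add: simps swap[of x y])
qed

text \<open>
  This is why \<open>h\<close> is closed under the bracket of degree one elements; both the induced differential
  on the quotient and the vanishing of the obstruction on \<open>h \<times> h\<close> rest on it.
\<close>

lemma polarized_jacobiator_morphism:
  assumes "\<And>x y. f (b x y) = b' (f x) (f y)" and "\<And>x y. f (c x y) = c' (f x) (f y)"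
    and "linear_over s t f"
  shows "f (polarized_jacobiator b c x y z) = polarized_jacobiator b' c' (f x) (f y) (f z)"
  unfolding polarized_jacobiator_def
  by (simp add: linear_over_simps[OF assms(3)] assms(1,2))

lemma alt_maps_1D:
  assumes "P \<in> alt_maps s t 1" shows "linear_over s t (\<lambda>x. P [x])"
  using alt_maps_linear_hd[of P s t 0 "[]"] assms by simp

lemma list_fun_zeroI:
  assumes "\<And>xs. length xs \<noteq> n \<Longrightarrow> P xs = 0" "\<And>xs. length xs = n \<Longrightarrow> P xs = 0"
  shows "P = 0"
  using assms by (metis ext zero_fun_apply)

section \<open>The infinitesimal meaning of the vanishing cohomology\<close>

text \<open>
  If the quotient of the cocycles by the coboundaries is trivial, then translating the coset of zero
  by the class of a cocycle \<open>c\<close> yields again a set of coboundaries. Spelling this out with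
  representatives shows that \<open>c\<close> is a coboundary up to an element of \<open>h 1\<close>.
\<close>

lemma quot_H1_trivialD:
  fixes g h :: "nat \<Rightarrow> 'a::ab_group_add set" and d :: "nat \<Rightarrow> 'a \<Rightarrow> 'a"
  assumes trivial: "trivial_group (quot_H1 g h d)"
    and zero: "0 \<in> g 0" "0 \<in> h 0" "0 \<in> h 1"
    and g0_closed: "\<And>x y. x \<in> h 0 \<Longrightarrow> y \<in> g 0 \<Longrightarrow> x + y \<in> g 0"
    and h2_add: "\<And>x y. x \<in> h 2 \<Longrightarrow> y \<in> h 2 \<Longrightarrow> x + y \<in> h 2"
    and h2_diff: "\<And>x y. x \<in> h 2 \<Longrightarrow> y \<in> h 2 \<Longrightarrow> x - y \<in> h 2"
    and d_zero: "d 0 0 = 0" and d_add: "\<And>x y. d 1 (x + y) = d 1 x + d 1 y"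
    and d_h1: "\<And>y. y \<in> h 1 \<Longrightarrow> d 1 y \<in> h 2"
    and c: "c \<in> g 1" "d 1 c \<in> h 2"
  shows "\<exists>x\<in>g 0. c - d 0 x \<in> h 1"
proof -
  have coset: "H #>\<^bsub>additive_group X\<^esub> a = (\<lambda>x. x + a) ` H" for H X and a :: 'a
    by (auto simp: r_coset_def additive_group_def)
  define Q where "Q = quot_group g h 1"
  define K where "K = kernel Q (quot_group g h 2) (quot_diff g h d 1)"
  define Bd where "Bd = quot_diff g h d 0 ` carrier (quot_group g h 0)"
  have quot_carrier: "carrier (quot_group g h k) = {(\<lambda>x. x + a) ` h k |a. a \<in> g k}" for k
    by (auto simp: quot_group_def FactGroup_def RCOSETS_def coset) (auto simp: additive_group_def)
  have diff_eq: "quot_diff g h d k C = (\<Union>x\<in>C. (\<lambda>y. y + d k x) ` h (k + 1))" for k C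
    by (simp add: quot_diff_def coset)
  define C where "C = (\<lambda>x. x + c) ` h 1"
  have "quot_diff g h d 1 C = h 2"
  proof -
    have "d 1 (y + c) \<in> h 2" if "y \<in> h 1" for y using that d_add d_h1 c h2_add by simp
    then have dh: "d 1 x \<in> h 2" if "x \<in> C" for x using that by (auto simp: C_def)
    have C_eq: "quot_diff g h d 1 C = (\<Union>x\<in>C. (\<lambda>y. y + d 1 x) ` h 2)"
      unfolding diff_eq one_add_one ..
    have "z \<in> (\<lambda>y. y + d 1 c) ` h 2" if "z \<in> h 2" for z
      using h2_diff[OF that c(2)] by (intro image_eqI[of _ _ "z - d 1 c"]) auto
    moreover have "c \<in> C" unfolding C_def using zero by (intro image_eqI[of _ _ 0]) auto
    ultimately have "h 2 \<subseteq> quot_diff g h d 1 C" unfolding C_eq by blast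
    moreover have "quot_diff g h d 1 C \<subseteq> h 2" unfolding C_eq using dh h2_add by blast
    ultimately show ?thesis by blast
  qed
  moreover have "C \<in> carrier Q" unfolding Q_def quot_carrier C_def using c by blast
  moreover have "one (quot_group g h 2) = h 2" by (simp add: quot_group_def FactGroup_def)
  ultimately have "C \<in> K" unfolding K_def kernel_def by simp
  moreover have "carrier (quot_H1 g h d) = (\<lambda>C. Bd #>\<^bsub>Q\<lparr>carrier := K\<rparr>\<^esub> C) ` K"
    by (auto simp: quot_H1_def FactGroup_def RCOSETS_def Q_def K_def Bd_def)
  moreover have "one (quot_H1 g h d) = Bd" by (simp add: quot_H1_def FactGroup_def Bd_def)
  ultimately have BC: "Bd #>\<^bsub>Q\<lparr>carrier := K\<rparr>\<^esub> C = Bd"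
    using trivial unfolding trivial_group_def by blast
  \<comment> \<open>translating the zero coboundary by the class of \<open>c\<close> gives a coboundary\<close>
  have "quot_diff g h d 0 (h 0) \<in> Bd"
    unfolding Bd_def quot_carrier using zero by (auto intro!: image_eqI[of _ _ "h 0"] exI[of _ 0])
  then have "quot_diff g h d 0 (h 0) <#>\<^bsub>additive_group (g 1)\<^esub> C \<in> Bd"
    using BC by (auto simp: r_coset_def Q_def quot_group_def FactGroup_def)
  then obtain a where a: "a \<in> g 0"
    "quot_diff g h d 0 (h 0) <#>\<^bsub>additive_group (g 1)\<^esub> C = quot_diff g h d 0 ((\<lambda>x. x + a) ` h 0)"
    by (auto simp: Bd_def quot_carrier)
  have "0 + d 0 0 \<in> quot_diff g h d 0 (h 0)"
    unfolding diff_eq using zero by (intro UN_I[of 0] image_eqI[of _ _ 0]) auto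
  moreover have "c \<in> C" unfolding C_def using zero by (intro image_eqI[of _ _ 0]) auto
  ultimately have "c \<in> quot_diff g h d 0 ((\<lambda>x. x + a) ` h 0)"
    unfolding a(2)[symmetric] d_zero by (force simp: set_mult_def additive_group_def)
  then obtain y x where "y \<in> h 1" "x \<in> h 0" "c = y + d 0 (x + a)"
    by (auto simp: diff_eq)
  then show ?thesis using g0_closed a(1) by (intro bexI[of _ "x + a"]) auto
qed

text \<open>
  The cohomological hypothesis in the form in which it is used: bilinear pairs annihilated by the
  linearized obstruction are coboundaries modulo compatible pairs.
\<close>

lemma infinitesimal_stability:
  fixes sV :: "'k::{real_normed_field,euclidean_space} \<Rightarrow> 'v::real_normed_vector \<Rightarrow> 'v"
    and sW :: "'k \<Rightarrow> 'w::real_normed_vector \<Rightarrow> 'w"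
  assumes V: "vector_space sV" and W: "vector_space sW"
    and \<mu>: "alt_bilinear sV sV \<mu>" and \<nu>: "alt_bilinear sW sW \<nu>"
    and f: "lie_morphism sV sW \<mu> \<nu> f"
    and trivial: "trivial_group (quot_H1 (g_space sV sW) (h_space sV sW f) (g_diff \<mu> \<nu>))"
    and \<alpha>: "alt_bilinear sV sV \<alpha>" and \<beta>: "alt_bilinear sW sW \<beta>"
    and cocycle: "\<And>x y z. f (polarized_jacobiator \<mu> \<alpha> x y z) =
      polarized_jacobiator \<nu> \<beta> (f x) (f y) (f z)"
  shows "\<exists>a\<in>endos sV. \<exists>b\<in>endos sW. \<forall>x y.
    f (\<alpha> x y - coboundary \<mu> a x y) = \<beta> (f x) (f y) - coboundary \<nu> b (f x) (f y)"
proof -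
  interpret V: vector_space sV by (rule V)
  interpret W: vector_space sW by (rule W)
  have lf: "linear_over sV sW f" and fm: "\<And>x y. f (\<mu> x y) = \<nu> (f x) (f y)"
    using f by (auto simp: lie_morphism_def)
  let ?g = "g_space sV sW" and ?h = "h_space sV sW f" and ?d = "g_diff \<mu> \<nu>"
  let ?c = "(bin_cochain \<alpha>, bin_cochain \<beta>)"
  have alt2: "bin_cochain \<mu> \<in> alt_maps sV sV 2" "bin_cochain \<nu> \<in> alt_maps sW sW 2"
    "bin_cochain \<alpha> \<in> alt_maps sV sV 2" "bin_cochain \<beta> \<in> alt_maps sW sW 2"
    using \<mu> \<nu> \<alpha> \<beta> by (auto intro: bin_cochain_alt_maps)
  have bin_apply: "(\<lambda>x y. bin_cochain b [x, y]) = b" for b :: "'x \<Rightarrow> 'x \<Rightarrow> 'x::zero"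
    by (simp add: bin_cochain_def)
  have d_g1: "?d 1 x \<in> ?g 2" if "x \<in> ?g 1" for x
    using that alt2 nr_bracket_1_1_alt_maps[OF V] nr_bracket_1_1_alt_maps[OF W]
    by (auto simp: g_diff_def g_bracket_def g_space_def numeral_2_eq_2 numeral_3_eq_3)
  have d_h2I: "?d 1 x \<in> ?h 2" if x: "x \<in> ?g 1"
    and eq: "\<And>y z w. f (polarized_jacobiator \<mu> (\<lambda>x' y. fst x [x', y]) y z w) =
        polarized_jacobiator \<nu> (\<lambda>x' y. snd x [x', y]) (f y) (f z) (f w)" for x
  proof -
    have "F_map f (?d 1 x) = 0"
    proof (rule list_fun_zeroI[of 3])
      fix xs :: "'v list" assume "length xs \<noteq> 3"
      then show "F_map f (?d 1 x) xs = 0"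
        by (simp add: F_map_def g_diff_def g_bracket_def nr_bracket_def nr_insert_def
            linear_over_simps(3)[OF lf])
    next
      fix xs :: "'v list" assume "length xs = 3"
      then obtain y z w where "xs = [y, z, w]"
        by (auto simp: numeral_3_eq_3 length_Suc_conv)
      then show "F_map f (?d 1 x) xs = 0"
        using eq[of y z w] nr_bracket_1_1[of "bin_cochain \<mu>" "fst x"]
          nr_bracket_1_1[of "bin_cochain \<nu>" "snd x"]
        by (simp add: F_map_def g_diff_def g_bracket_def bin_apply)
    qed
    then show ?thesis using d_g1[OF x] by (simp add: h_space_def)
  qed
  have c: "?c \<in> ?g 1" using alt2 by (simp add: g_space_def numeral_2_eq_2)
  have g_zero: "0 \<in> ?g k" for k
    by (simp add: g_space_def zero_prod_def V.zero_alt_maps W.zero_alt_maps)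
  have g_add: "x + y \<in> ?g k" and g_diff: "x - y \<in> ?g k" if "x \<in> ?g k" "y \<in> ?g k" for x y k
    using that by (auto simp: g_space_def V.add_alt_maps W.add_alt_maps V.diff_alt_maps
        W.diff_alt_maps)
  have F_zero: "F_map f 0 = 0" and F_add: "F_map f (x + y) = F_map f x + F_map f y"
    and F_diff: "F_map f (x - y) = F_map f x - F_map f y" for x y
    by (auto simp: F_map_def fun_eq_iff linear_over_simps[OF lf])
  have d_add: "?d k (x + y) = ?d k x + ?d k y" for k x y
    using nr_bracket_add_right[of "bin_cochain \<mu>" sV 1, unfolded one_add_one, OF alt2(1)]
      nr_bracket_add_right[of "bin_cochain \<nu>" sW 1, unfolded one_add_one, OF alt2(2)]
    by (simp add: g_diff_def g_bracket_def)
  have "\<exists>x\<in>?g 0. ?c - ?d 0 x \<in> ?h 1"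
  proof (rule quot_H1_trivialD[OF trivial])
    show "?c \<in> ?g 1" by (rule c)
    show "?d 1 ?c \<in> ?h 2"
      by (rule d_h2I[OF c]) (simp add: bin_apply cocycle)
    show "0 \<in> ?g 0" by (rule g_zero)
    show "0 \<in> ?h 0" "0 \<in> ?h 1" using g_zero by (simp_all add: h_space_def F_zero)
    show "x + y \<in> ?g 0" if "x \<in> ?h 0" "y \<in> ?g 0" for x y
      using that g_add by (simp add: h_space_def)
    show "x + y \<in> ?h 2" "x - y \<in> ?h 2" if "x \<in> ?h 2" "y \<in> ?h 2" for x y
      using that g_add[of x 2 y] g_diff[of x 2 y] F_add[of x y] F_diff[of x y]
      by (simp_all add: h_space_def)
    show "?d 1 (x + y) = ?d 1 x + ?d 1 y" for x y by (rule d_add)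
    have "?d 0 (0 + 0) = ?d 0 0 + ?d 0 0" by (rule d_add)
    then show "?d 0 0 = 0" by simp
    fix y assume y: "y \<in> ?h 1"
    have "f (fst y [x, z]) = snd y [f x, f z]" for x z
    proof -
      have "F_map f y [x, z] = 0" using y by (simp add: h_space_def)
      then show ?thesis by (simp add: F_map_def)
    qed
    then show "?d 1 y \<in> ?h 2"
      using y polarized_jacobiator_morphism[where b = \<mu> and b' = \<nu> and
          c = "\<lambda>x z. fst y [x, z]" and c' = "\<lambda>x z. snd y [x, z]", OF fm _ lf]
      by (intro d_h2I) (auto simp: h_space_def)
  qed
  then obtain P Q where PQ: "P \<in> alt_maps sV sV 1" "Q \<in> alt_maps sW sW 1" "?c - ?d 0 (P, Q) \<in> ?h 1"
    by (auto simp: g_space_def)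
  define a where "a = (\<lambda>x. P [x])"
  define b where "b = (\<lambda>x. Q [x])"
  have "f (\<alpha> x y - coboundary \<mu> a x y) = \<beta> (f x) (f y) - coboundary \<nu> b (f x) (f y)" for x y
  proof -
    have "F_map f (?c - ?d 0 (P, Q)) [x, y] = 0" using PQ(3) by (simp add: h_space_def)
    then show ?thesis
      using nr_bracket_1_0[OF \<mu>, of P x y] nr_bracket_1_0[OF \<nu>, of Q "f x" "f y"]
      by (simp add: F_map_def g_diff_def g_bracket_def a_def b_def bin_cochain_def)
  qed
  moreover have "a \<in> endos sV" "b \<in> endos sW"
    using PQ alt_maps_1D by (auto simp: endos_def a_def b_def)
  ultimately show ?thesis by blast
qed

section \<open>Structure constants and the gauge action\<close>

text \<open>
  Inserting one argument into the structure constants of a bilinear map leaves the matrix of an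
  endomorphism, so that bilinear maps can be treated with \<open>endo_of\<close>.
\<close>

definition contract :: "'k::comm_semiring_1^'n^'n^'n \<Rightarrow> 'k^'n \<Rightarrow> 'k^'n^'n"
  where "contract m u = (\<chi> p. m $ p *v u)"

lemma bounded_bilinear_contract:
  "bounded_bilinear (contract :: 'k::{real_normed_field,euclidean_space}^'n^'n^'n \<Rightarrow> _)"
proof -
  interpret mv: bounded_bilinear "(*v) :: 'k^'n^'n \<Rightarrow> _" by (rule bounded_bilinear_matrix_vector_mult)
  have "bilinear (contract :: 'k^'n^'n^'n \<Rightarrow> _)"
    unfolding bilinear_def contract_def[abs_def]
    by (auto intro!: linearI simp: vec_eq_iff mv.add_left mv.add_right mv.scaleR_left mv.scaleR_right)
  then show ?thesis by (simp add: bilinear_conv_bounded_bilinear)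
qed

definition bilinear_over :: "('k::field \<Rightarrow> 'v::ab_group_add \<Rightarrow> 'v) \<Rightarrow> ('v \<Rightarrow> 'v \<Rightarrow> 'v) \<Rightarrow> bool"
  where "bilinear_over s b \<longleftrightarrow> (\<forall>x. linear_over s s (b x)) \<and> (\<forall>y. linear_over s s (\<lambda>x. b x y))"

context coordinates begin

definition bilin_of :: "'k^'n^'n^'n \<Rightarrow> 'v \<Rightarrow> 'v \<Rightarrow> 'v"
  where "bilin_of m x = endo_of (contract m (j x))"

definition tensor_of :: "('v \<Rightarrow> 'v \<Rightarrow> 'v) \<Rightarrow> 'k^'n^'n^'n"
  where "tensor_of b = (\<chi> p q l. j (b (r (axis l 1)) (r (axis q 1))) $ p)"

lemma bilin_of_tensor_of:
  assumes b: "bilinear_over s b" shows "bilin_of (tensor_of b) = b"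
proof (intro ext)
  fix x y
  have lin: "linear_over s s (b x)" "linear_over s s (\<lambda>x. b x y)" for x y
    using b by (auto simp: bilinear_over_def)
  note b_simps = linear_over_simps[OF lin(1)] linear_over_simps[OF lin(2)]
  have vs: "vector_space ((*s) :: 'k \<Rightarrow> 'k^'n \<Rightarrow> _)" ..
  have row: "tensor_of b $ p *v j x = (\<chi> q. j (b x (r (axis q 1))) $ p)" for p
  proof -
    define g where "g = (\<lambda>u. \<chi> q. j (b (r u) (r (axis q 1))) $ p)"
    have "linear_over (*s) (*s) g"
      unfolding Vector_Spaces.linear_iff using vs
      by (auto simp: g_def vec_eq_iff r.add r.scale b_simps j.add j.scale)
    moreover have "tensor_of b $ p = matrix g" by (simp add: matrix_def g_def tensor_of_def)
    ultimately show ?thesis by (simp add: matrix_works g_def)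
  qed
  have "linear_over (*s) (*s) (\<lambda>u. j (b x (r u)))"
    unfolding Vector_Spaces.linear_iff using vs
    by (auto simp: r.add r.scale b_simps j.add j.scale)
  moreover have "contract (tensor_of b) (j x) = matrix (\<lambda>u. j (b x (r u)))"
    by (simp add: contract_def row matrix_def)
  ultimately show "bilin_of (tensor_of b) x y = b x y"
    by (simp add: bilin_of_def endo_of_def matrix_works)
qed

lemma bilin_of_bilinear: "bilinear_over s (bilin_of m)"
  unfolding bilinear_over_def
proof (intro conjI allI)
  show "linear_over s s (bilin_of m x)" for x
    using endo_of_endos by (simp add: endos_def bilin_of_def)
  have e: "(\<chi> p. c *s w p) *v u = c *s ((\<chi> p. w p) *v u)" for c :: 'k and w :: "'n \<Rightarrow> 'k^'n" and u
    by (simp add: vec_eq_iff matrix_vector_mult_def sum_distrib_left mult_ac)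
  interpret c: bounded_bilinear "contract :: 'k^'n^'n^'n \<Rightarrow> _" by (rule bounded_bilinear_contract)
  have "contract m (c *s u) = (\<chi> p. c *s (m $ p *v u))" for c u
    by (simp add: contract_def vec_eq_iff matrix_vector_mult_def sum_distrib_left mult_ac)
  then show "linear_over s s (\<lambda>x. bilin_of m x y)" for y
    unfolding Vector_Spaces.linear_iff
    by (auto simp: vector_space_axioms bilin_of_def j.add c.add_right endo_of.add_left endo_of_def
        j.scale e r.scale contract_def[of m] r.add matrix_vector_mult_add_rdistrib)
qed

lemma bilin_of_linear:
  "bilin_of (m + m') x y = bilin_of m x y + bilin_of m' x y"
  "bilin_of (m - m') x y = bilin_of m x y - bilin_of m' x y"
  "bilin_of (c *\<^sub>R m) x y = c *\<^sub>R bilin_of m x y" "bilin_of 0 x y = 0"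
proof -
  interpret c: bounded_bilinear "contract :: 'k^'n^'n^'n \<Rightarrow> _" by (rule bounded_bilinear_contract)
  show "bilin_of (m + m') x y = bilin_of m x y + bilin_of m' x y"
    "bilin_of (m - m') x y = bilin_of m x y - bilin_of m' x y"
    "bilin_of (c *\<^sub>R m) x y = c *\<^sub>R bilin_of m x y" "bilin_of 0 x y = 0"
    by (simp_all add: bilin_of_def c.add_left c.diff_left c.scaleR_left c.zero_left endo_of.add_left
        endo_of.diff_left endo_of.scaleR_left endo_of.zero_left)
qed

lemma tensor_of_linear:
  "tensor_of (\<lambda>x y. b x y + b' x y) = tensor_of b + tensor_of b'"
  "tensor_of (\<lambda>x y. b x y - b' x y) = tensor_of b - tensor_of b'"
  "tensor_of (\<lambda>x y. c *\<^sub>R b x y) = c *\<^sub>R tensor_of b" "tensor_of (\<lambda>x y. 0) = 0"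
  by (simp_all add: tensor_of_def vec_eq_iff j.add j.diff j.zero
      linear_scale[OF bounded_linear.linear[OF j_bounded]])

text \<open>
  Structure constants are evaluations on coordinate vectors, hence continuous for the topology of
  pointwise convergence. This is what turns neighbourhoods in the coordinate space into
  neighbourhoods of Lie algebra structures.
\<close>

lemma tensor_of_continuous: "continuous_on UNIV tensor_of"
proof -
  have eval: "continuous_on UNIV (\<lambda>b :: 'v \<Rightarrow> 'v \<Rightarrow> 'v. b x y)" for x y
    by (rule continuous_on_product_then_coordinatewise[OF continuous_on_product_coordinates])
  show ?thesis
    unfolding tensor_of_def[abs_def]
    by (intro continuous_on_vec_lambda continuous_on_component
        bounded_linear.continuous_on[OF j_bounded] eval)
qed

text \<open>
  The images of the coordinate vectors span the space.
\<close>

lemma linear_over_eq_zero: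
  assumes "linear_over s t g" and "\<And>i. g (r (axis i 1)) = 0" shows "g x = 0"
proof -
  interpret g: Vector_Spaces.linear s t g by fact
  have "g x = g (r (\<Sum>i\<in>UNIV. j x $ i *s axis i 1))" by (simp add: basis_expansion)
  also have "\<dots> = (\<Sum>i\<in>UNIV. t (j x $ i) (g (r (axis i 1))))"
    by (simp only: g.sum g.scale r.sum r.scale)
  finally show ?thesis by (simp add: assms(2))
qed

text \<open>
  Linearity over the scalar field passes from the partial sums to the limit since multiplication by a
  scalar is continuous.
\<close>

lemma endo_exp_endos: "endo_exp (endo_of a) \<in> endos s"
proof -
  define A where "A = endo_of a"
  have lin: "linear_over s s (A ^^ n)" for n
  proof (induction n)
    case 0
    show ?case by (simp add: id_def) (rule linear_id[unfolded id_def])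
  next
    case (Suc n)
    then show ?case
      using Vector_Spaces.linear_compose[of s s "A ^^ n" s A] endo_of_endos[of a]
      by (simp add: A_def endos_def comp_def)
  qed
  note simps = linear_over_simps[OF lin]
  have sums: "(\<lambda>n. (A ^^ n) v /\<^sub>R fact n) sums endo_exp A v" for v
    unfolding A_def by (rule endo_exp_sums)
  have scale_bounded: "bounded_linear (s c)" for c
  proof -
    have "s c \<in> endos s"
      unfolding endos_def mem_Collect_eq Vector_Spaces.linear_iff
      by (auto simp: vector_space_axioms scale_right_distrib mult.commute)
    then have "s c = endo_of (matrix_of (s c))" by (simp add: endo_of_matrix_of)
    then show ?thesis by (metis endo_of.bounded_linear_right)
  qed
  have add: "endo_exp A (x + y) = endo_exp A x + endo_exp A y" for x y
    using sums_unique2[OF sums[of "x + y"]] sums_add[OF sums[of x] sums[of y]]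
    by (simp add: simps scaleR_add_right)
  have scale: "endo_exp A (s c x) = s c (endo_exp A x)" for c x
  proof -
    have "s c ((A ^^ n) x /\<^sub>R fact n) = (A ^^ n) (s c x) /\<^sub>R fact n" for n
      by (simp add: simps mult.commute flip: s_of_real)
    then show ?thesis
      using sums_unique2[OF sums[of "s c x"]] bounded_linear.sums[OF scale_bounded[of c] sums[of x]]
      by simp
  qed
  show ?thesis
    unfolding endos_def mem_Collect_eq Vector_Spaces.linear_iff
    using add scale vector_space_axioms by (simp add: A_def)
qed

definition exp_matrix :: "'k^'n^'n \<Rightarrow> 'k^'n^'n"
  where "exp_matrix a = matrix_of (endo_exp (endo_of a))"

lemma endo_of_exp_matrix: "endo_of (exp_matrix a) = endo_exp (endo_of a)"
  unfolding exp_matrix_def by (rule endo_of_matrix_of[OF endo_exp_endos])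

lemma matrix_of_eq: "matrix_of A = (\<chi> p q. j (A (r (axis q 1))) $ p)"
  by (simp add: matrix_of_def matrix_def)

lemma exp_matrix_continuous: "continuous_on UNIV exp_matrix"
  unfolding exp_matrix_def[abs_def] matrix_of_eq
  by (intro continuous_intros bounded_linear.continuous_on[OF j_bounded] endo_exp_continuous)

lemma exp_matrix_has_derivative:
  "(exp_matrix has_derivative (\<lambda>h. matrix_of (endo_of h))) (at 0)"
  unfolding exp_matrix_def[abs_def] matrix_of_eq
  by (intro has_derivative_vec_lambda bounded_linear.has_derivative[OF bounded_linear_vec_nth]
      bounded_linear.has_derivative[OF j_bounded] endo_exp_has_derivative)

text \<open>
  Because of the redundancy of the coordinates, \<open>tensor_of (bilin_of m)\<close> need not be \<open>m\<close>; at \<open>a = 0\<close> this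
  map is therefore a projection onto the honest structure constants rather than the identity.
\<close>

definition twist_coord :: "('k^'n^'n) \<times> ('k^'n^'n^'n) \<Rightarrow> 'k^'n^'n^'n"
  where "twist_coord = (\<lambda>(a, m). tensor_of (twist (endo_of a) (bilin_of m)))"

lemma twist_coord_eq:
  "twist_coord p = tensor_of (\<lambda>x y. endo_of (exp_matrix (fst p))
    (endo_of (contract (snd p) (j (endo_of (exp_matrix (- fst p)) x))) (endo_of (exp_matrix (- fst p)) y)))"
  by (simp add: twist_coord_def twist_def bilin_of_def case_prod_unfold endo_of_exp_matrix endo_of_minus)

lemma twist_coord_continuous: "continuous_on UNIV twist_coord"
proof -
  have E: "continuous_on UNIV (\<lambda>p :: ('k^'n^'n) \<times> ('k^'n^'n^'n). exp_matrix (fst p))"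
    "continuous_on UNIV (\<lambda>p :: ('k^'n^'n) \<times> ('k^'n^'n^'n). exp_matrix (- fst p))"
    by (auto intro!: continuous_on_compose2[OF exp_matrix_continuous] continuous_intros)
  show ?thesis
    unfolding twist_coord_eq[abs_def] tensor_of_def
    by (intro continuous_on_vec_lambda continuous_on_component bounded_linear.continuous_on[OF j_bounded]
        endo_of.continuous_on bounded_bilinear.continuous_on[OF bounded_bilinear_contract]
        E continuous_on_const continuous_on_snd continuous_on_id)
qed

lemma endo_exp_zero: "endo_exp (endo_of 0) v = v"
  using endo_exp_remainder[of "endo_of 0" 0 v] by (simp add: endo_of.zero_left)

text \<open>
  Twisting is composed of bilinear maps and of \<open>exp_matrix\<close>, whose derivative at \<open>0\<close> is the identity up
  to redundancy of the coordinates. The product rule gives minus the coboundary in the direction of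
  the gauge parameter.
\<close>

lemma twist_coord_has_derivative:
  "(twist_coord has_derivative (\<lambda>(h, d). tensor_of (\<lambda>x y.
    bilin_of d x y - coboundary (bilin_of m) (endo_of h) x y))) (at (0, m))"
proof -
  have X: "((\<lambda>p. exp_matrix (fst p)) has_derivative (\<lambda>p. matrix_of (endo_of (fst p)))) (at (0, m))"
    using has_derivative_compose[of fst fst "(0, m)" UNIV exp_matrix "\<lambda>h. matrix_of (endo_of h)"]
      exp_matrix_has_derivative by (simp add: has_derivative_fst)
  have Y: "((\<lambda>p. exp_matrix (- fst p)) has_derivative (\<lambda>p. matrix_of (endo_of (- fst p)))) (at (0, m))"
    using has_derivative_compose[of "\<lambda>p. - fst p" "\<lambda>p. - fst p" "(0, m)" UNIV exp_matrix "\<lambda>h. matrix_of (endo_of h)"]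
      exp_matrix_has_derivative by (simp add: has_derivative_fst has_derivative_minus)
  have simps: "endo_of (exp_matrix 0) = (\<lambda>v. v)" "endo_of (matrix_of (endo_of h)) = endo_of h" for h
    by (auto simp: endo_of_exp_matrix endo_exp_zero endo_of_matrix_of endo_of_endos)
  have Yv: "((\<lambda>p. endo_of (exp_matrix (- fst p)) v) has_derivative (\<lambda>p. - endo_of (fst p) v)) (at (0, m))" for v
    using bounded_linear.has_derivative[OF endo_of.bounded_linear_left Y, of v]
    by (simp add: simps endo_of.minus_left)
  interpret c: bounded_bilinear "contract :: 'k^'n^'n^'n \<Rightarrow> _" by (rule bounded_bilinear_contract)
  have C: "((\<lambda>p. contract (snd p) (j (endo_of (exp_matrix (- fst p)) v))) has_derivative
      (\<lambda>p. contract m (j (- endo_of (fst p) v)) + contract (snd p) (j v))) (at (0, m))" for v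
    using c.FDERIV[OF has_derivative_snd[OF has_derivative_ident] bounded_linear.has_derivative[OF j_bounded Yv[of v]]]
    by (simp add: simps)
  have D: "((\<lambda>p. endo_of (exp_matrix (fst p)) (endo_of (contract (snd p)
        (j (endo_of (exp_matrix (- fst p)) v))) (endo_of (exp_matrix (- fst p)) w)))
      has_derivative (\<lambda>p. bilin_of (snd p) v w - coboundary (bilin_of m) (endo_of (fst p)) v w)) (at (0, m))"
    for v w
    using endo_of.FDERIV[OF X endo_of.FDERIV[OF C[of v] Yv[of w]]]
    by (simp add: simps coboundary_def bilin_of_def endo_of.add_left endo_of.diff_left endo_of.minus_right j.neg
        c.minus_right endo_of.minus_left algebra_simps)
  show ?thesis
    unfolding twist_coord_eq[abs_def] tensor_of_def case_prod_unfold
    by (intro has_derivative_vec_lambda bounded_linear.has_derivative[OF bounded_linear_vec_nth]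
        bounded_linear.has_derivative[OF j_bounded] D)
qed

end

section \<open>Stability of morphisms\<close>

lemma lie_structures_alt_bilinear:
  assumes "\<mu> \<in> lie_structures s" shows "alt_bilinear s s \<mu>"
  using assms by (auto simp: lie_structures_def alt_bilinear_def)

lemma alt_bilinear_bilinear_over: "alt_bilinear s s b \<Longrightarrow> bilinear_over s b"
  by (simp add: alt_bilinear_def bilinear_over_def)

lemma polarized_jacobiator_lie_structure:
  assumes "\<mu> \<in> lie_structures s" shows "polarized_jacobiator \<mu> \<mu> x y z = 0"
proof -
  have b: "alt_bilinear s s \<mu>" using assms by (rule lie_structures_alt_bilinear)
  note swap = alt_bilinear_swap[OF b]
  have "\<mu> (\<mu> x y) z - \<mu> (\<mu> x z) y + \<mu> (\<mu> y z) x =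
      - (\<mu> x (\<mu> y z) + \<mu> y (\<mu> z x) + \<mu> z (\<mu> x y))"
    using swap[of z "\<mu> x y"] swap[of y "\<mu> x z"] swap[of x "\<mu> y z"] swap[of x z]
    by (simp add: alt_bilinear_simps(5,6)[OF b])
  also have "\<dots> = 0" using assms by (simp add: lie_structures_def)
  finally show ?thesis by (simp add: polarized_jacobiator_def)
qed

lemma (in vector_space) coboundary_alt_bilinear:
  assumes b: "alt_bilinear scale scale b" and a: "a \<in> endos scale"
  shows "alt_bilinear scale scale (coboundary b a)"
proof -
  have la: "linear_over scale scale a" using a by (simp add: endos_def)
  have lb: "linear_over scale scale (b x)" "linear_over scale scale (\<lambda>x. b x y)" for x y
    using b by (auto simp: alt_bilinear_def)
  note lin = linear_over_closed(2)[OF linear_over_closed(1)]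
  note comp = linear_over_closed(3)
  show ?thesis
    unfolding alt_bilinear_def coboundary_def
    by (intro conjI allI lin[OF lb(1) comp[OF lb(1) la] comp[OF la lb(1)]]
        lin[OF comp[OF lb(2) la] lb(2) comp[OF la lb(2)]])
      (simp add: alt_bilinear_swap[OF b, of _ "a _"] alt_bilinear_simps(11)[OF b] linear_over_simps(3)[OF la])
qed

context coordinates begin

lemma twist_alt_bilinear:
  assumes b: "alt_bilinear s s b" shows "alt_bilinear s s (twist (endo_of a) b)"
proof -
  have le: "linear_over s s (endo_exp (endo_of a))" for a
    using endo_exp_endos by (simp add: endos_def)
  have lb: "linear_over s s (b x)" "linear_over s s (\<lambda>x. b x y)" for x y
    using b by (auto simp: alt_bilinear_def)
  note comp = linear_over_closed(3)
  show ?thesis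
    unfolding alt_bilinear_def twist_def endo_of_minus[symmetric]
    by (intro conjI allI comp[OF le comp[OF lb(1) le]] comp[OF le comp[OF lb(2) le]])
      (simp add: alt_bilinear_simps(11)[OF b] linear_over_simps(3)[OF le])
qed

text \<open>
  Twisting is transport of structure along the invertible map \<open>exp\<close>.
\<close>

lemma twist_lie_structures:
  assumes \<mu>: "\<mu> \<in> lie_structures s" shows "twist (endo_of a) \<mu> \<in> lie_structures s"
proof -
  let ?e = "endo_exp (endo_of a)" and ?e' = "endo_exp (- endo_of a)" and ?t = "twist (endo_of a) \<mu>"
  have le: "linear_over s s ?e" using endo_exp_endos by (simp add: endos_def)
  have "?t x (?t y z) + ?t y (?t z x) + ?t z (?t x y) = 0" for x y z
  proof -
    have "?t u (?t v w) = ?e (\<mu> (?e' u) (\<mu> (?e' v) (?e' w)))" for u v w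
      by (simp add: twist_def endo_exp_minus_inverse)
    then have "?t x (?t y z) + ?t y (?t z x) + ?t z (?t x y) =
        ?e (\<mu> (?e' x) (\<mu> (?e' y) (?e' z)) + \<mu> (?e' y) (\<mu> (?e' z) (?e' x)) + \<mu> (?e' z) (\<mu> (?e' x) (?e' y)))"
      by (simp add: linear_over_simps(1)[OF le])
    also have "\<dots> = 0" using \<mu> linear_over_simps(3)[OF le] by (simp add: lie_structures_def)
    finally show ?thesis .
  qed
  then show ?thesis
    using twist_alt_bilinear[OF lie_structures_alt_bilinear[OF \<mu>], of a]
    by (auto simp: lie_structures_def alt_bilinear_def)
qed

lemma twist_zero: "twist (endo_of 0) b = b"
  by (simp add: fun_eq_iff twist_def endo_exp_zero flip: endo_of_minus)

lemma bilin_of_args: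
  "bilin_of m (x + x') y = bilin_of m x y + bilin_of m x' y"
  "bilin_of m (c *\<^sub>R x) y = c *\<^sub>R bilin_of m x y"
  "bilin_of m x (y + y') = bilin_of m x y + bilin_of m x y'"
  "bilin_of m x (c *\<^sub>R y) = c *\<^sub>R bilin_of m x y"
proof -
  have "linear (bilin_of m x)" "linear (\<lambda>x. bilin_of m x y)" for x y
    using bilin_of_bilinear[of m] linear_over_imp_linear by (auto simp: bilinear_over_def)
  note lin = this
  show "bilin_of m (x + x') y = bilin_of m x y + bilin_of m x' y"
    "bilin_of m (c *\<^sub>R x) y = c *\<^sub>R bilin_of m x y"
    "bilin_of m x (y + y') = bilin_of m x y + bilin_of m x y'"
    "bilin_of m x (c *\<^sub>R y) = c *\<^sub>R bilin_of m x y"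
    using linear_add[OF lin(1)] linear_scale[OF lin(1)] linear_add[OF lin(2)] linear_scale[OF lin(2)]
    by simp_all
qed

lemma polarized_jacobiator_bilin_of:
  "polarized_jacobiator (bilin_of (m + m')) (bilin_of n) x y z =
    polarized_jacobiator (bilin_of m) (bilin_of n) x y z + polarized_jacobiator (bilin_of m') (bilin_of n) x y z"
  "polarized_jacobiator (bilin_of (c *\<^sub>R m)) (bilin_of n) x y z =
    c *\<^sub>R polarized_jacobiator (bilin_of m) (bilin_of n) x y z"
  by (simp_all add: polarized_jacobiator_def bilin_of_linear bilin_of_args algebra_simps)

definition alternating :: "('k^'n^'n^'n) set"
  where "alternating = {m. tensor_of (bilin_of m) = m \<and> (\<forall>x. bilin_of m x x = 0)}"

lemma alternating_alt_bilinear: "m \<in> alternating \<Longrightarrow> alt_bilinear s s (bilin_of m)"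
  using bilin_of_bilinear by (simp add: alternating_def alt_bilinear_def bilinear_over_def)

lemma bilin_of_tensor_of_alt: "alt_bilinear s s b \<Longrightarrow> bilin_of (tensor_of b) = b"
  by (intro bilin_of_tensor_of alt_bilinear_bilinear_over)

lemma tensor_of_alternating: "alt_bilinear s s b \<Longrightarrow> tensor_of b \<in> alternating"
  by (simp add: alternating_def bilin_of_tensor_of_alt) (simp add: alt_bilinear_def)

lemma subspace_alternating: "Real_Vector_Spaces.subspace alternating"
proof -
  have "bilin_of (m + n) = (\<lambda>x y. bilin_of m x y + bilin_of n x y)"
    "bilin_of (c *\<^sub>R m) = (\<lambda>x y. c *\<^sub>R bilin_of m x y)" "bilin_of 0 = (\<lambda>x y. 0)" for m n c
    by (simp_all add: fun_eq_iff bilin_of_linear)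
  then show ?thesis
    by (auto simp: real_vector.subspace_def alternating_def tensor_of_linear)
qed

end

lemma polarized_jacobiator_commute: "polarized_jacobiator b c = polarized_jacobiator c b"
  by (simp add: fun_eq_iff polarized_jacobiator_def add.commute)

locale coordinates_pair =
  V: coordinates sV jV rV + W: coordinates sW jW rW
  for sV :: "'k::{real_normed_field,euclidean_space} \<Rightarrow> 'v::real_normed_vector \<Rightarrow> 'v"
    and jV :: "'v \<Rightarrow> 'k^'n::finite" and rV
    and sW :: "'k \<Rightarrow> 'w::real_normed_vector \<Rightarrow> 'w"
    and jW :: "'w \<Rightarrow> 'k^'p::finite" and rW +
  fixes f :: "'v \<Rightarrow> 'w"
  assumes f_linear: "linear_over sV sW f"
begin

lemmas f_simps = linear_over_simps[OF f_linear]

lemma f_scaleR: "f (c *\<^sub>R x) = c *\<^sub>R f x"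
  by (simp add: f_simps flip: V.s_of_real W.s_of_real)

definition compatible :: "(('k^'n^'n^'n) \<times> ('k^'p^'p^'p)) set"
  where "compatible = {p \<in> V.alternating \<times> W.alternating.
    \<forall>x y. f (V.bilin_of (fst p) x y) = W.bilin_of (snd p) (f x) (f y)}"

text \<open>
  The map \<open>F\<close> in degree two applied to the bracket of two pairs of bilinear maps.
\<close>

definition defect ::
    "('k^'n^'n^'n) \<times> ('k^'p^'p^'p) \<Rightarrow> ('k^'n^'n^'n) \<times> ('k^'p^'p^'p) \<Rightarrow> 'v \<Rightarrow> 'v \<Rightarrow> 'v \<Rightarrow> 'w"
  where "defect p q x y z =
    f (polarized_jacobiator (V.bilin_of (fst p)) (V.bilin_of (fst q)) x y z) -
    polarized_jacobiator (W.bilin_of (snd p)) (W.bilin_of (snd q)) (f x) (f y) (f z)"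

text \<open>
  The values of the defect on coordinate vectors. They determine it, as it is trilinear on alternating
  arguments, and they form a Euclidean space.
\<close>

definition obstruction ::
    "('k^'n^'n^'n) \<times> ('k^'p^'p^'p) \<Rightarrow> ('k^'n^'n^'n) \<times> ('k^'p^'p^'p) \<Rightarrow> 'k^'p^'n^'n^'n"
  where "obstruction p q =
    (\<chi> i l k. jW (defect p q (rV (axis i 1)) (rV (axis l 1)) (rV (axis k 1))))"

definition act ::
    "(('k^'n^'n) \<times> ('k^'p^'p)) \<times> (('k^'n^'n^'n) \<times> ('k^'p^'p^'p)) \<Rightarrow> ('k^'n^'n^'n) \<times> ('k^'p^'p^'p)"
  where "act q = (V.twist_coord (fst (fst q), fst (snd q)), W.twist_coord (snd (fst q), snd (snd q)))"

lemma defect_commute: "defect p q = defect q p"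
  by (simp add: fun_eq_iff defect_def polarized_jacobiator_commute)

lemma obstruction_commute: "obstruction p q = obstruction q p"
  by (simp add: obstruction_def defect_commute[of p q])

lemma obstruction_bounded_bilinear: "bounded_bilinear obstruction"
proof -
  have add: "obstruction (p + p') q = obstruction p q + obstruction p' q" for p p' q
    by (simp add: obstruction_def defect_def V.polarized_jacobiator_bilin_of
        W.polarized_jacobiator_bilin_of vec_eq_iff f_simps W.j.diff W.j.add)
  have scale: "obstruction (c *\<^sub>R p) q = c *\<^sub>R obstruction p q" for c p q
    by (simp add: obstruction_def defect_def V.polarized_jacobiator_bilin_of
        W.polarized_jacobiator_bilin_of vec_eq_iff f_scaleR W.j.diff
        linear_scale[OF bounded_linear.linear[OF W.j_bounded]] scaleR_diff_right)
  have "bilinear obstruction"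
    unfolding bilinear_def
  proof (intro conjI allI)
    show "linear (obstruction p)" for p
      by (rule linearI) (simp_all only: obstruction_commute[of p] add scale)
    show "linear (\<lambda>p. obstruction p q)" for q
      by (rule linearI) (simp_all only: add scale)
  qed
  then show ?thesis by (simp add: bilinear_conv_bounded_bilinear)
qed

lemma obstruction_zeroD:
  assumes p: "p \<in> V.alternating \<times> W.alternating" and q: "q \<in> V.alternating \<times> W.alternating"
    and zero: "obstruction p q = 0"
  shows "defect p q x y z = 0"
proof -
  interpret VW: vector_space_pair sV sW ..
  have alt: "alt_bilinear sV sV (V.bilin_of (fst p))" "alt_bilinear sV sV (V.bilin_of (fst q))"
    "alt_bilinear sW sW (W.bilin_of (snd p))" "alt_bilinear sW sW (W.bilin_of (snd q))"
    using p q V.alternating_alt_bilinear W.alternating_alt_bilinear by auto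
  note linV = polarized_jacobiator_linear[OF V.vector_space_axioms alt(1,2)]
  note linW = polarized_jacobiator_linear[OF W.vector_space_axioms alt(3,4)]
  have comp: "linear_over sV sW (\<lambda>x. f (g x) - h (f x))"
    if "linear_over sV sV g" "linear_over sW sW h" for g h
    using VW.linear_compose_sub[OF Vector_Spaces.linear_compose[OF that(1) f_linear]
        Vector_Spaces.linear_compose[OF f_linear that(2)]] by (simp add: comp_def)
  have lin: "linear_over sV sW (\<lambda>x. defect p q x y z)" "linear_over sV sW (\<lambda>y. defect p q x y z)"
    "linear_over sV sW (\<lambda>z. defect p q x y z)" for x y z
    unfolding defect_def by (intro comp linV linW)+
  have "defect p q (rV (axis i 1)) (rV (axis l 1)) (rV (axis k 1)) = 0" for i l k
  proof -
    have "jW (defect p q (rV (axis i 1)) (rV (axis l 1)) (rV (axis k 1))) = 0"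
      using zero by (simp add: obstruction_def vec_eq_iff)
    then show ?thesis by (metis W.r_j W.r.zero)
  qed
  then have "defect p q (rV (axis i 1)) (rV (axis l 1)) z = 0" for i l z
    using V.linear_over_eq_zero[OF lin(3)] by blast
  then have "defect p q (rV (axis i 1)) y z = 0" for i y z
    using V.linear_over_eq_zero[OF lin(2)] by blast
  then show ?thesis
    using V.linear_over_eq_zero[OF lin(1)] by blast
qed

lemma obstruction_compatible:
  assumes "p \<in> compatible" "q \<in> compatible" shows "obstruction p q = 0"
proof -
  have "defect p q x y z = 0" for x y z
    unfolding defect_def
    using polarized_jacobiator_morphism[of f "V.bilin_of (fst p)" "W.bilin_of (snd p)"
        "V.bilin_of (fst q)" "W.bilin_of (snd q)", OF _ _ f_linear] assms
    by (simp add: compatible_def)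
  then show ?thesis by (simp add: obstruction_def vec_eq_iff W.j.zero)
qed

lemma act_continuous: "continuous_on UNIV act"
  unfolding act_def[abs_def]
  by (intro continuous_on_Pair continuous_on_compose2[OF V.twist_coord_continuous]
      continuous_on_compose2[OF W.twist_coord_continuous] continuous_intros subset_UNIV)

lemma act_has_derivative:
  "(act has_derivative (\<lambda>q.
    (V.tensor_of (\<lambda>x y. V.bilin_of (fst (snd q)) x y -
        coboundary (V.bilin_of m) (V.endo_of (fst (fst q))) x y),
     W.tensor_of (\<lambda>x y. W.bilin_of (snd (snd q)) x y -
        coboundary (W.bilin_of n) (W.endo_of (snd (fst q))) x y)))) (at (0, (m, n)))"
proof -
  have pr: "((\<lambda>q. (fst (fst q), fst (snd q))) has_derivative (\<lambda>q. (fst (fst q), fst (snd q))))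
      (at (0 :: ('k^'n^'n) \<times> ('k^'p^'p), (m, n)))"
    "((\<lambda>q. (snd (fst q), snd (snd q))) has_derivative (\<lambda>q. (snd (fst q), snd (snd q))))
      (at (0 :: ('k^'n^'n) \<times> ('k^'p^'p), (m, n)))"
    by (auto intro!: derivative_eq_intros)
  have "((\<lambda>q. V.twist_coord (fst (fst q), fst (snd q))) has_derivative
      (\<lambda>q. V.tensor_of (\<lambda>x y. V.bilin_of (fst (snd q)) x y -
        coboundary (V.bilin_of m) (V.endo_of (fst (fst q))) x y))) (at (0 :: ('k^'n^'n) \<times> ('k^'p^'p), (m, n)))"
    using has_derivative_compose[OF pr(1), of V.twist_coord, simplified, OF
        V.twist_coord_has_derivative[of m]] by (simp add: case_prod_unfold)
  moreover have "((\<lambda>q. W.twist_coord (snd (fst q), snd (snd q))) has_derivative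
      (\<lambda>q. W.tensor_of (\<lambda>x y. W.bilin_of (snd (snd q)) x y -
        coboundary (W.bilin_of n) (W.endo_of (snd (fst q))) x y))) (at (0 :: ('k^'n^'n) \<times> ('k^'p^'p), (m, n)))"
    using has_derivative_compose[OF pr(2), of W.twist_coord, simplified, OF
        W.twist_coord_has_derivative[of n]] by (simp add: case_prod_unfold)
  ultimately show ?thesis
    unfolding act_def[abs_def] by (rule has_derivative_Pair)
qed

lemma subspace_compatible: "subspace compatible"
proof -
  have "subspace (V.alternating \<times> W.alternating)"
    by (intro subspace_Times V.subspace_alternating W.subspace_alternating)
  then show ?thesis
    unfolding subspace_def compatible_def
    by (auto simp: V.bilin_of_linear W.bilin_of_linear f_simps f_scaleR zero_prod_def)
qed

text \<open>
  The general rigidity principle applied to the gauge action on structure constants. For a Lie pair the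
  obstruction vanishes along its whole gauge orbit, since twisting preserves Lie algebra structures.
\<close>

lemma stability:
  assumes \<mu>: "\<mu> \<in> lie_structures sV" and \<nu>: "\<nu> \<in> lie_structures sW"
    and f_morphism: "\<And>x y. f (\<mu> x y) = \<nu> (f x) (f y)"
    and infinitesimal: "\<And>\<alpha> \<beta>. alt_bilinear sV sV \<alpha> \<Longrightarrow> alt_bilinear sW sW \<beta> \<Longrightarrow>
      (\<And>x y z. f (polarized_jacobiator \<mu> \<alpha> x y z) = polarized_jacobiator \<nu> \<beta> (f x) (f y) (f z)) \<Longrightarrow>
      \<exists>a\<in>endos sV. \<exists>b\<in>endos sW. \<forall>x y.
        f (\<alpha> x y - coboundary \<mu> a x y) = \<beta> (f x) (f y) - coboundary \<nu> b (f x) (f y)"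
  shows "\<exists>U. open U \<and> (\<mu>, \<nu>) \<in> U \<and>
    (\<forall>(\<mu>', \<nu>') \<in> U \<inter> (lie_structures sV \<times> lie_structures sW).
      \<exists>A\<in>endos sV. \<exists>B\<in>endos sW. lie_morphism sV sW (twist A \<mu>') (twist B \<nu>') f)"
proof -
  define S where "S = V.alternating \<times> W.alternating"
  define m0 where "m0 = (V.tensor_of \<mu>, W.tensor_of \<nu>)"
  have alt: "alt_bilinear sV sV \<mu>" "alt_bilinear sW sW \<nu>"
    using \<mu> \<nu> lie_structures_alt_bilinear by auto
  have bil: "V.bilin_of (fst m0) = \<mu>" "W.bilin_of (snd m0) = \<nu>"
    by (simp_all add: m0_def V.bilin_of_tensor_of_alt W.bilin_of_tensor_of_alt alt)
  have m0S: "m0 \<in> S"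
    by (simp add: m0_def S_def V.tensor_of_alternating W.tensor_of_alternating alt)
  define act' where "act' = (\<lambda>q.
      (V.tensor_of (\<lambda>x y. V.bilin_of (fst (snd q)) x y -
          coboundary (V.bilin_of (fst m0)) (V.endo_of (fst (fst q))) x y),
       W.tensor_of (\<lambda>x y. W.bilin_of (snd (snd q)) x y -
          coboundary (W.bilin_of (snd m0)) (W.endo_of (snd (fst q))) x y)))"
  have "\<exists>U. open U \<and> m0 \<in> U \<and> (\<forall>p\<in>U \<inter> S.
      (\<forall>e. obstruction (act (e, p)) (act (e, p)) = 0) \<longrightarrow> (\<exists>e. act (e, p) \<in> compatible))"
  proof (rule rigidity_of_zero_set[where T = act and T' = act' and B = obstruction and h = compatible])
    show "subspace S" unfolding S_def
      by (intro subspace_Times V.subspace_alternating W.subspace_alternating)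
    show "subspace compatible" by (rule subspace_compatible)
    show "compatible \<subseteq> S" by (auto simp: compatible_def S_def)
    show "m0 \<in> compatible" using m0S by (simp add: compatible_def S_def bil f_morphism)
    show "bounded_bilinear obstruction" by (rule obstruction_bounded_bilinear)
    show "obstruction p q = obstruction q p" for p q by (rule obstruction_commute)
    show "obstruction p q = 0" if "p \<in> compatible" "q \<in> compatible" for p q
      using that by (rule obstruction_compatible)
    show "continuous_on UNIV act" by (rule act_continuous)
    show "(act has_derivative act') (at (0, m0))"
      unfolding act'_def using act_has_derivative[of "fst m0" "snd m0"] by simp
    show "act (0, m0) = m0"
      by (simp add: act_def V.twist_coord_def W.twist_coord_def bil V.twist_zero W.twist_zero)
        (simp add: m0_def)
    show "act (e, p) \<in> S" if "p \<in> S" for e p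
      using that
      by (auto simp: S_def act_def V.twist_coord_def W.twist_coord_def
          intro!: V.tensor_of_alternating W.tensor_of_alternating V.twist_alt_bilinear
          W.twist_alt_bilinear V.alternating_alt_bilinear W.alternating_alt_bilinear)
    fix p assume p: "p \<in> S" and zero: "obstruction m0 p = 0"
    let ?\<alpha> = "V.bilin_of (fst p)" and ?\<beta> = "W.bilin_of (snd p)"
    have pa: "fst p \<in> V.alternating" "snd p \<in> W.alternating" using p by (auto simp: S_def)
    have "f (polarized_jacobiator \<mu> ?\<alpha> x y z) = polarized_jacobiator \<nu> ?\<beta> (f x) (f y) (f z)" for x y z
      using obstruction_zeroD[of m0 p x y z] m0S p zero by (simp add: S_def defect_def bil)
    then obtain a b where a: "a \<in> endos sV" and b: "b \<in> endos sW" and ab: "\<And>x y.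
        f (?\<alpha> x y - coboundary \<mu> a x y) = ?\<beta> (f x) (f y) - coboundary \<nu> b (f x) (f y)"
      using infinitesimal[of ?\<alpha> ?\<beta>] V.alternating_alt_bilinear[OF pa(1)]
        W.alternating_alt_bilinear[OF pa(2)] by blast
    \<comment> \<open>The sign accounts for the derivative of the twist being minus the coboundary.\<close>
    define e where "e = (- V.matrix_of a, - W.matrix_of b)"
    have cob: "alt_bilinear sV sV (coboundary \<mu> a)" "alt_bilinear sW sW (coboundary \<nu> b)"
      using alt a b V.coboundary_alt_bilinear W.coboundary_alt_bilinear by auto
    have neg: "0 - coboundary c (- g) x y = coboundary c g x y"
      if "alt_bilinear s s c" for s :: "'k \<Rightarrow> 'x::ab_group_add \<Rightarrow> 'x" and c g x y
      by (simp add: coboundary_def alt_bilinear_simps(5,6)[OF that])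
    have endo_e: "V.endo_of (fst e) = - a" "W.endo_of (snd e) = - b"
      by (simp_all add: e_def V.endo_of_minus W.endo_of_minus V.endo_of_matrix_of W.endo_of_matrix_of a b)
    have "p - (V.tensor_of (coboundary \<mu> a), W.tensor_of (coboundary \<nu> b)) \<in> compatible"
      unfolding compatible_def
      using ab subspace_diff[OF V.subspace_alternating pa(1) V.tensor_of_alternating[OF cob(1)]]
        subspace_diff[OF W.subspace_alternating pa(2) W.tensor_of_alternating[OF cob(2)]]
      by (simp add: mem_Times_iff V.bilin_of_linear W.bilin_of_linear V.bilin_of_tensor_of_alt
          W.bilin_of_tensor_of_alt cob)
    then show "\<exists>e. p - act' (e, 0) \<in> compatible"
      unfolding act'_def
      by (intro exI[of _ e])
        (simp add: bil endo_e V.bilin_of_linear W.bilin_of_linear neg[OF alt(1), simplified]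
          neg[OF alt(2), simplified])
  qed
  then obtain U where U: "open U" "m0 \<in> U" and U_act: "\<And>p. p \<in> U \<inter> S \<Longrightarrow>
      (\<And>e. obstruction (act (e, p)) (act (e, p)) = 0) \<Longrightarrow> \<exists>e. act (e, p) \<in> compatible"
    by blast
  define U' where "U' = (\<lambda>q. (V.tensor_of (fst q), W.tensor_of (snd q))) -` U"
  have "open U'"
    unfolding U'_def
    by (intro open_vimage U continuous_on_Pair continuous_on_compose2[OF V.tensor_of_continuous]
        continuous_on_compose2[OF W.tensor_of_continuous] continuous_on_fst continuous_on_snd
        continuous_on_id subset_UNIV)
  moreover have "(\<mu>, \<nu>) \<in> U'" using U(2) by (simp add: U'_def m0_def)
  moreover have "\<exists>A\<in>endos sV. \<exists>B\<in>endos sW. lie_morphism sV sW (twist A \<mu>') (twist B \<nu>') f"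
    if in_U: "(\<mu>', \<nu>') \<in> U'" and \<mu>': "\<mu>' \<in> lie_structures sV" and \<nu>': "\<nu>' \<in> lie_structures sW"
    for \<mu>' \<nu>'
  proof -
    define p where "p = (V.tensor_of \<mu>', W.tensor_of \<nu>')"
    have alt': "alt_bilinear sV sV \<mu>'" "alt_bilinear sW sW \<nu>'"
      using \<mu>' \<nu>' lie_structures_alt_bilinear by auto
    have pU: "p \<in> U \<inter> S"
      using in_U alt' by (simp add: p_def U'_def S_def V.tensor_of_alternating W.tensor_of_alternating)
    have act_bil: "V.bilin_of (fst (act (e, p))) = twist (V.endo_of (fst e)) \<mu>'"
      "W.bilin_of (snd (act (e, p))) = twist (W.endo_of (snd e)) \<nu>'" for e
      using alt' by (simp_all add: act_def p_def V.twist_coord_def W.twist_coord_def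
          V.bilin_of_tensor_of_alt W.bilin_of_tensor_of_alt V.twist_alt_bilinear W.twist_alt_bilinear)
    have "obstruction (act (e, p)) (act (e, p)) = 0" for e
      using polarized_jacobiator_lie_structure[OF V.twist_lie_structures[OF \<mu>']]
        polarized_jacobiator_lie_structure[OF W.twist_lie_structures[OF \<nu>']]
      by (simp add: obstruction_def defect_def act_bil f_simps W.j.zero vec_eq_iff)
    then obtain e where "act (e, p) \<in> compatible" using U_act[OF pU] by blast
    then have "lie_morphism sV sW (twist (V.endo_of (fst e)) \<mu>') (twist (W.endo_of (snd e)) \<nu>') f"
      using f_linear by (simp add: compatible_def lie_morphism_def act_bil)
    then show ?thesis using V.endo_of_endos W.endo_of_endos by blast
  qed
  ultimately show ?thesis by (intro exI[of _ U']) auto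
qed

end

lemma (in vector_space) zero_derivations:
  assumes "\<mu> \<in> lie_structures scale" shows "0 \<in> derivations scale \<mu>"
proof -
  have "linear_over scale scale (\<lambda>v. 0)" by unfold_locales simp_all
  then show ?thesis
    using alt_bilinear_simps(7,8)[OF lie_structures_alt_bilinear[OF assms]]
    by (simp add: derivations_def endos_def zero_fun_def)
qed

text \<open>
  A single pair \<open>(A, B)\<close> that makes \<open>f\<close> a morphism of the twisted algebras gives a family: the constant
  one, parametrized by all pairs of derivations.
\<close>

theorem theorem3p20:
  fixes sV :: "'k::{real_normed_field,euclidean_space} \<Rightarrow> 'v::real_normed_vector \<Rightarrow> 'v"
    and sW :: "'k \<Rightarrow> 'w::real_normed_vector \<Rightarrow> 'w"
    and BV :: "'v set" and BW :: "'w set"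
    and \<mu> :: "'v \<Rightarrow> 'v \<Rightarrow> 'v" and \<nu> :: "'w \<Rightarrow> 'w \<Rightarrow> 'w"
    and f :: "'v \<Rightarrow> 'w"
  assumes "fd_space sV BV" and "fd_space sW BW"
    and "\<mu> \<in> lie_structures sV" and "\<nu> \<in> lie_structures sW"
    and "lie_morphism sV sW \<mu> \<nu> f"
    and "trivial_group (quot_H1 (g_space sV sW) (h_space sV sW f) (g_diff \<mu> \<nu>))"
  shows "\<exists>U. openin (top_of_set (lie_structures sV \<times> lie_structures sW)) U \<and> (\<mu>, \<nu>) \<in> U \<and>
    (\<forall>(\<mu>', \<nu>') \<in> U.
      \<exists>N \<Phi>. openin (top_of_set (derivations sV \<mu> \<times> derivations sW \<nu>)) N \<and> 0 \<in> N \<and>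
        \<Phi> \<in> N \<rightarrow> endos sV \<times> endos sW \<and>
        (\<forall>D \<in> N. case \<Phi> D of (A, B) \<Rightarrow>
          lie_morphism sV sW (twist A \<mu>') (twist B \<nu>') f))"
proof -
  obtain jV :: "'v \<Rightarrow> 'k^'v coord_index" and rV where V: "coordinates sV jV rV"
    using coordinates_exist[OF assms(1)] by blast
  obtain jW :: "'w \<Rightarrow> 'k^'w coord_index" and rW where W: "coordinates sW jW rW"
    using coordinates_exist[OF assms(2)] by blast
  have "linear_over sV sW f" and f_morphism: "\<And>x y. f (\<mu> x y) = \<nu> (f x) (f y)"
    using assms(5) by (auto simp: lie_morphism_def)
  then interpret coordinates_pair sV jV rV sW jW rW f
    by (intro coordinates_pair.intro coordinates_pair_axioms.intro V W)
  let ?N = "derivations sV \<mu> \<times> derivations sW \<nu>"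
  let ?L = "lie_structures sV \<times> lie_structures sW"
  note infinitesimal = infinitesimal_stability[OF V.vector_space_axioms W.vector_space_axioms
      assms(3,4)[THEN lie_structures_alt_bilinear] assms(5,6)]
  have "\<exists>U. open U \<and> (\<mu>, \<nu>) \<in> U \<and> (\<forall>(\<mu>', \<nu>') \<in> U \<inter> ?L.
      \<exists>A\<in>endos sV. \<exists>B\<in>endos sW. lie_morphism sV sW (twist A \<mu>') (twist B \<nu>') f)"
    by (rule stability[OF assms(3,4) f_morphism]) (rule infinitesimal)
  then obtain U where U: "open U" "(\<mu>, \<nu>) \<in> U" and stable: "\<forall>(\<mu>', \<nu>') \<in> U \<inter> ?L.
      \<exists>A\<in>endos sV. \<exists>B\<in>endos sW. lie_morphism sV sW (twist A \<mu>') (twist B \<nu>') f"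
    by (elim exE conjE)
  have "0 \<in> ?N"
    using V.zero_derivations[OF assms(3)] W.zero_derivations[OF assms(4)] by (simp add: zero_prod_def)
  have "openin (top_of_set ?L) (U \<inter> ?L)" 
    using openin_open_Int[OF U(1), of ?L] by (simp only: Int_commute)
  moreover have "\<exists>N \<Phi>. openin (top_of_set ?N) N \<and> 0 \<in> N \<and> \<Phi> \<in> N \<rightarrow> endos sV \<times> endos sW \<and>
      (\<forall>D \<in> N. case \<Phi> D of (A, B) \<Rightarrow> lie_morphism sV sW (twist A \<mu>') (twist B \<nu>') f)"
    if in_U: "(\<mu>', \<nu>') \<in> U \<inter> ?L" for \<mu>' \<nu>'
  proof -
    obtain A B where "A \<in> endos sV" "B \<in> endos sW" "lie_morphism sV sW (twist A \<mu>') (twist B \<nu>') f"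
      using bspec[OF stable in_U] by (auto split: prod.splits)
    then show ?thesis
      using \<open>0 \<in> ?N\<close> by (intro exI[of _ ?N] exI[of _ "\<lambda>_. (A, B)"]) auto
  qed
  ultimately show ?thesis using U(2) assms(3,4) by (intro exI[of _ "U \<inter> ?L"]) auto
qed

end
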